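(* Let $V$ be a 2-dimensional complex vector space and let $R:V^{\otimes 3}\to V^{\otimes 3}$ be the $(2,3,2)$ generalized Yang-Baxter operator represented on the lexicographically ordered basis of $V^{\otimes 3}$ by $$R=\frac{1}{\sqrt{2}}\begin{pmatrix} I&J\\-J&I \end{pmatrix},\qquad J=\begin{pmatrix} 0&0&0&1\\0&0&1&0\\0&1&0&0\\1&0&0&0 \end{pmatrix},$$ where $I$ is the $4\times 4$ identity matrix. Let $\mu=\mathrm{Id}_V$, $\alpha=1$, $\beta=2\sqrt{2}$. Then $S=(R,\mu,\alpha,\beta)$ is an enhanced generalized Yang-Baxter operator (with $k=3$, $m=2$) whose associated oriented link invariant $T_S$ satisfies $$T_S(L_+)+T_S(L_-)=\sqrt{2}\,T_S(L_0)$$ for every triple $(L_-,L_0,L_+)$, and $T_S(G_n)=(\sqrt{2})^{-n}2^{n-1}$ for all $n\ge 1$, where $G_n$ is the trivial $n$-component link.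
   Context: $V$ is a finite-dimensional complex vector space of dimension $d$; $I_m$ denotes the identity of $V^{\otimes m}$. $B_n$ is the braid group with generators $\sigma_1,\dots,\sigma_{n-1}$ (positive crossings) and relations $\sigma_i\sigma_j=\sigma_j\sigma_i$ for $|i-j|\ge 2$, $\sigma_i\sigma_{i+1}\sigma_i=\sigma_{i+1}\sigma_i\sigma_{i+1}$. Operator trace. For a basis $v_1,\dots,v_d$ of $V$ and $f\in\mathrm{End}(V^{\otimes k})$ write $f(v_{i_1}\otimes\cdots\otimes v_{i_k})=\sum f^{j_1,\dots,j_k}_{i_1,\dots,i_k}v_{j_1}\otimes\cdots\otimes v_{j_k}$. For $m<k$, $\mathrm{Sp}_{k,m}:\mathrm{End}(V^{\otimes k})\to\mathrm{End}(V^{\otimes (k-m)})$ is the partial trace over the last $m$ tensor factors: $\mathrm{Sp}_{k,m}(f)(v_{i_1}\otimes\cdots\otimes v_{i_{k-m}})=\sum_{j_1,\dots,j_{k-m},l_1,\dots,l_m}f^{j_1,\dots,j_{k-m},l_1,\dots,l_m}_{i_1,\dots,i_{k-m},l_1,\dots,l_m}v_{j_1}\otimes\cdots\otimes v_{j_{k-m}}$ (independent of the basis). Generalized Yang-Baxter operator (gYB-operator) of type $(d,k,m)$: an isomorphism $R:V^{\otimes k}\to V^{\otimes k}$, $\dim V=d$, with $(R\otimes I_m)(I_m\otimes R)(R\otimes I_m)=(I_m\otimes R)(R\otimes I_m)(I_m\otimes R)$ and $(R\otimes I_m^{\otimes(j-2)})(I_m^{\otimes(j-2)}\otimes R)=(I_m^{\otimes(j-2)}\otimes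 R)(R\otimes I_m^{\otimes(j-2)})$ for all $j\ge 4$. It gives a representation $\rho^R_n:B_n\to\mathrm{End}(V^{\otimes k+m(n-2)})$, $\sigma_i\mapsto I_m^{\otimes(i-1)}\otimes R\otimes I_m^{\otimes(n-i-1)}$, with image $\mathrm{im}(\rho^R_n)$. It is known (Rowell, Zhang, Wu, Ge) that the displayed $R$ is a unitary gYB-operator of type $(2,3,2)$. Perpendicular subspace: for $A\subset\mathrm{End}(W)$, $A^\perp=\{g\in\mathrm{End}(W):\mathrm{tr}(f^*\circ g)=0\text{ for all }f\in A\}$, where $f^*$ is the hermitian conjugate of $f$ (conjugate transpose in the tensor basis induced by the fixed basis of $V$). Enhanced generalized Yang-Baxter operator (EgYB-operator): fix positive integers $m<k$. It is a collection $S=(R,\mu,\alpha,\beta)$ of a gYB-operator $R:V^{\otimes k}\to V^{\otimes k}$ of type $(d,k,m)$, a linear map $\mu:V\to V$, and invertible $\alpha,\beta\in\mathbb{C}$ such that, for all $n\geq 1$: (i) $\mu^{\otimes k}$ commutes with $R$; (ii) $\mu^{\otimes m(n-1)}\otimes(\mathrm{Sp}_{k,m}(R\circ\mu^{\otimes k})-\alpha\beta\mu^{\otimes (k-m)})\in\mathrm{im}(\rho^R_n)^\perp$ and $\mu^{\otimes m(n-1)}\otimes(\mathrm{Sp}_{k,m}(R^{-1}\circ\mu^{\otimes k})-\alpha^{-1}\beta\mu^{\otimes (k-m)})\in\mathrm{im}(\rho^R_n)^\perp$. The invariant $T_S$: let $w:B_n\to\mathbb{Z}$ be the homomorphism with $w(\sigma_i)=1$.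 For $\xi\in B_n$, $T_S(\xi)=\alpha^{-w(\xi)}\beta^{-n}\,\mathrm{tr}\big(\rho^R_n(\xi)\circ\mu^{\otimes k+m(n-2)}\big)$. For an oriented link $L$, $T_S(L)=T_S(\xi)$ where $\xi$ is any braid whose closure is isotopic to $L$ (well defined, by invariance under Markov moves and Markov's theorem). A triple $(L_-,L_0,L_+)$ consists of oriented links with diagrams identical outside a disk, inside which $L_0$ has two parallel (uncrossed) strands and $L_+$, $L_-$ have one positive, respectively one negative, crossing. Equivalently, there is a braid $\xi\in B_n$ such that $L_0,L_+,L_-$ are the closures of $\xi$, $\sigma_1\xi$, $\sigma_1^{-1}\xi$. *)

theory Defs
  imports
    "Jordan_Normal_Form.Gauss_Jordan_Elimination"
    "Jordan_Normal_Form.Schur_Decomposition"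
    "HOL-Analysis.Elementary_Topology"
begin

section \<open>Operators on tensor powers\<close>

text \<open>
  A basis of \<open>V\<close>, \<open>dim V = d\<close>, is fixed. A basis vector of \<open>V\<^sup>\<otimes>\<^sup>k\<close> with indices
  \<open>i\<^sub>1, \<dots>, i\<^sub>k < d\<close> has position \<open>i\<^sub>1 d\<^sup>k\<^sup>-\<^sup>1 + \<dots> + i\<^sub>k\<close> in the lexicographic order, and an
  endomorphism of \<open>V\<^sup>\<otimes>\<^sup>k\<close> is the \<open>d ^ k \<times> d ^ k\<close> matrix whose \<open>j\<close>-th column holds the
  coordinates of the image of the \<open>j\<close>-th basis vector. The tensor product of
  endomorphisms is then the Kronecker product.
\<close>

definition kron :: "complex mat \<Rightarrow> complex mat \<Rightarrow> complex mat" (infixl "\<otimes>\<^sub>K" 75) where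
  "A \<otimes>\<^sub>K B = mat (dim_row A * dim_row B) (dim_col A * dim_col B)
     (\<lambda>(i, j). A $$ (i div dim_row B, j div dim_col B) * B $$ (i mod dim_row B, j mod dim_col B))"

primrec tensor_power :: "complex mat \<Rightarrow> nat \<Rightarrow> complex mat" where
  "tensor_power A 0 = 1\<^sub>m 1"
| "tensor_power A (Suc k) = A \<otimes>\<^sub>K tensor_power A k"

definition mat_trace :: "complex mat \<Rightarrow> complex" where
  "mat_trace A = (\<Sum>i<dim_row A. A $$ (i, i))"

definition mat_inv :: "complex mat \<Rightarrow> complex mat" where
  "mat_inv A = the (mat_inverse A)"

text \<open>The operator trace \<open>Sp\<^sub>k\<^sub>,\<^sub>m\<close> over the last \<open>m\<close> of \<open>k\<close> tensor factors.\<close>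

definition op_trace :: "nat \<Rightarrow> nat \<Rightarrow> nat \<Rightarrow> complex mat \<Rightarrow> complex mat" where
  "op_trace d k m f = mat (d ^ (k - m)) (d ^ (k - m))
     (\<lambda>(i, j). \<Sum>l<d ^ m. f $$ (i * d ^ m + l, j * d ^ m + l))"

text \<open>\<open>A\<^sup>\<bottom>\<close> inside the endomorphisms of an \<open>N\<close>-dimensional space.\<close>

definition perp :: "nat \<Rightarrow> complex mat set \<Rightarrow> complex mat set" where
  "perp N A = {g \<in> carrier_mat N N. \<forall>f\<in>A. mat_trace (mat_adjoint f * g) = 0}"

definition gYB_operator :: "nat \<Rightarrow> nat \<Rightarrow> nat \<Rightarrow> complex mat \<Rightarrow> bool" where
  "gYB_operator d k m R \<longleftrightarrow>
     R \<in> carrier_mat (d ^ k) (d ^ k) \<and> invertible_mat R \<and>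
     (let I = 1\<^sub>m (d ^ m) in
       (R \<otimes>\<^sub>K I) * (I \<otimes>\<^sub>K R) * (R \<otimes>\<^sub>K I) = (I \<otimes>\<^sub>K R) * (R \<otimes>\<^sub>K I) * (I \<otimes>\<^sub>K R)) \<and>
     (\<forall>j\<ge>4. let I = 1\<^sub>m (d ^ (m * (j - 2))) in
       (R \<otimes>\<^sub>K I) * (I \<otimes>\<^sub>K R) = (I \<otimes>\<^sub>K R) * (R \<otimes>\<^sub>K I))"


section \<open>Braid groups\<close>

text \<open>The letter \<open>(i, True)\<close> stands for \<open>\<sigma>\<^sub>i\<close>, and \<open>(i, False)\<close> for its inverse.\<close>

type_synonym braid_word = "(nat \<times> bool) list"
type_synonym braid = "braid_word set"

definition braid_words :: "nat \<Rightarrow> braid_word set" where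
  "braid_words n = lists ({1..<n} \<times> UNIV)"

inductive braid_eq :: "nat \<Rightarrow> braid_word \<Rightarrow> braid_word \<Rightarrow> bool" for n where
  refl: "w \<in> braid_words n \<Longrightarrow> braid_eq n w w"
| sym: "braid_eq n u v \<Longrightarrow> braid_eq n v u"
| trans: "braid_eq n u v \<Longrightarrow> braid_eq n v w \<Longrightarrow> braid_eq n u w"
| append: "braid_eq n u u' \<Longrightarrow> braid_eq n v v' \<Longrightarrow> braid_eq n (u @ v) (u' @ v')"
| cancel: "1 \<le> i \<Longrightarrow> i < n \<Longrightarrow> braid_eq n [(i, e), (i, \<not> e)] []"
| far: "1 \<le> i \<Longrightarrow> i + 2 \<le> j \<Longrightarrow> j < n \<Longrightarrow>
    braid_eq n [(i, True), (j, True)] [(j, True), (i, True)]"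
| braid: "1 \<le> i \<Longrightarrow> i + 1 < n \<Longrightarrow>
    braid_eq n [(i, True), (i + 1, True), (i, True)] [(i + 1, True), (i, True), (i + 1, True)]"

definition braid_rel :: "nat \<Rightarrow> (braid_word \<times> braid_word) set" where
  "braid_rel n = {(u, v). braid_eq n u v}"

definition braid_group :: "nat \<Rightarrow> braid monoid" where
  "braid_group n =
     \<lparr>carrier = braid_words n // braid_rel n,
      monoid.mult = (\<lambda>X Y. braid_rel n `` {u @ v | u v. u \<in> X \<and> v \<in> Y}),
      one = braid_rel n `` {[]}\<rparr>"

definition sigma :: "nat \<Rightarrow> nat \<Rightarrow> braid" where
  "sigma n i = braid_rel n `` {[(i, True)]}"

text \<open>The standard map from \<open>B\<^sub>n\<close> to \<open>B\<^sub>n\<^sub>+\<^sub>1\<close> that adds a strand.\<close>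

definition add_strand :: "nat \<Rightarrow> braid \<Rightarrow> braid" where
  "add_strand n \<xi> = braid_rel (Suc n) `` \<xi>"

text \<open>The functions of a braid defined by \<open>SOME\<close> below do not depend on the chosen word.\<close>

definition writhe :: "braid \<Rightarrow> int" where
  "writhe \<xi> = (\<Sum>(i, e)\<leftarrow>(SOME w. w \<in> \<xi>). if e then 1 else - 1)"

text \<open>
  The representation of \<open>B\<^sub>n\<close> given by \<open>R\<close>, for \<open>n \<ge> 1\<close>. It acts on the tensor power of \<open>V\<close> with
  exponent \<open>k + m (n - 2) = (k - m) + m (n - 1)\<close>; the second form avoids truncation for \<open>n = 1\<close>.
\<close>

definition num_factors :: "nat \<Rightarrow> nat \<Rightarrow> nat \<Rightarrow> nat" where
  "num_factors k m n = (k - m) + m * (n - 1)"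

definition rho_letter :: "nat \<Rightarrow> nat \<Rightarrow> complex mat \<Rightarrow> nat \<Rightarrow> nat \<times> bool \<Rightarrow> complex mat" where
  "rho_letter d m R n = (\<lambda>(i, e).
     1\<^sub>m (d ^ (m * (i - 1))) \<otimes>\<^sub>K (if e then R else mat_inv R) \<otimes>\<^sub>K 1\<^sub>m (d ^ (m * (n - i - 1))))"

definition rho_word :: "nat \<Rightarrow> nat \<Rightarrow> nat \<Rightarrow> complex mat \<Rightarrow> nat \<Rightarrow> braid_word \<Rightarrow> complex mat" where
  "rho_word d k m R n w =
     foldr (\<lambda>x A. rho_letter d m R n x * A) w (1\<^sub>m (d ^ num_factors k m n))"

definition rho :: "nat \<Rightarrow> nat \<Rightarrow> nat \<Rightarrow> complex mat \<Rightarrow> nat \<Rightarrow> braid \<Rightarrow> complex mat" where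
  "rho d k m R n \<xi> = rho_word d k m R n (SOME w. w \<in> \<xi>)"


section \<open>Enhanced generalized Yang-Baxter operators\<close>

text \<open>A collection \<open>(R, \<mu>, \<alpha>, \<beta>)\<close>.\<close>

type_synonym enhanced = "complex mat \<times> complex mat \<times> complex \<times> complex"

definition EgYB_operator :: "nat \<Rightarrow> nat \<Rightarrow> nat \<Rightarrow> enhanced \<Rightarrow> bool" where
  "EgYB_operator d k m = (\<lambda>(R, \<mu>, \<alpha>, \<beta>).
     0 < m \<and> m < k \<and> gYB_operator d k m R \<and> \<mu> \<in> carrier_mat d d \<and> \<alpha> \<noteq> 0 \<and> \<beta> \<noteq> 0 \<and>
     tensor_power \<mu> k * R = R * tensor_power \<mu> k \<and>
     (\<forall>n\<ge>1. let im = rho d k m R n ` carrier (braid_group n); N = d ^ num_factors k m n in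
        tensor_power \<mu> (m * (n - 1)) \<otimes>\<^sub>K
          (op_trace d k m (R * tensor_power \<mu> k) - (\<alpha> * \<beta>) \<cdot>\<^sub>m tensor_power \<mu> (k - m))
          \<in> perp N im \<and>
        tensor_power \<mu> (m * (n - 1)) \<otimes>\<^sub>K
          (op_trace d k m (mat_inv R * tensor_power \<mu> k)
            - (inverse \<alpha> * \<beta>) \<cdot>\<^sub>m tensor_power \<mu> (k - m))
          \<in> perp N im))"

text \<open>\<open>T\<^sub>S\<close> as a function of the number \<open>n\<close> of strands and a braid in \<open>B\<^sub>n\<close>.\<close>

definition T_braid :: "nat \<Rightarrow> nat \<Rightarrow> nat \<Rightarrow> enhanced \<Rightarrow> nat \<Rightarrow> braid \<Rightarrow> complex" where
  "T_braid d k m = (\<lambda>(R, \<mu>, \<alpha>, \<beta>) n \<xi>.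
     \<alpha> powi (- writhe \<xi>) * \<beta> powi (- int n) *
     mat_trace (rho d k m R n \<xi> * tensor_power \<mu> (num_factors k m n)))"

definition markov_invariant :: "(nat \<Rightarrow> braid \<Rightarrow> 'a) \<Rightarrow> bool" where
  "markov_invariant F \<longleftrightarrow>
     (\<forall>n\<ge>1. \<forall>\<xi>\<in>carrier (braid_group n).
        (\<forall>\<eta>\<in>carrier (braid_group n).
           F n (\<eta> \<otimes>\<^bsub>braid_group n\<^esub> \<xi> \<otimes>\<^bsub>braid_group n\<^esub> inv\<^bsub>braid_group n\<^esub> \<eta>) = F n \<xi>) \<and>
        F (Suc n) (add_strand n \<xi> \<otimes>\<^bsub>braid_group (Suc n)\<^esub> sigma (Suc n) n) = F n \<xi> \<and>
        F (Suc n) (add_strand n \<xi> \<otimes>\<^bsub>braid_group (Suc n)\<^esub>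
          inv\<^bsub>braid_group (Suc n)\<^esub> sigma (Suc n) n) = F n \<xi>)"


section \<open>Oriented links and closed braids\<close>

text \<open>
  Three-space is \<open>\<complex> \<times> \<real>\<close>. A pair \<open>(c, \<gamma>)\<close> represents the link with components
  \<open>\<gamma> 0, \<dots>, \<gamma> (c - 1)\<close>, each parametrized with period 1 and oriented by increasing parameter.
\<close>

type_synonym link = "nat \<times> (nat \<Rightarrow> real \<Rightarrow> complex \<times> real)"

definition oriented_link :: "link \<Rightarrow> bool" where
  "oriented_link = (\<lambda>(c, \<gamma>).
     (\<forall>i<c. continuous_on UNIV (\<gamma> i)) \<and>
     (\<forall>i<c. \<forall>j<c. \<forall>s t. \<gamma> i s = \<gamma> j t \<longleftrightarrow> i = j \<and> s - t \<in> \<int>))"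

definition ambient_isotopy :: "(real \<Rightarrow> complex \<times> real \<Rightarrow> complex \<times> real) \<Rightarrow> bool" where
  "ambient_isotopy H \<longleftrightarrow>
     continuous_on ({0..1} \<times> UNIV) (\<lambda>(t, x). H t x) \<and>
     (\<forall>t\<in>{0..1}. \<exists>g. homeomorphism UNIV UNIV (H t) g) \<and> H 0 = id"

text \<open>Isotopic links; the components may be renumbered and reparametrized, keeping the orientation.\<close>

definition isotopic :: "link \<Rightarrow> link \<Rightarrow> bool" where
  "isotopic = (\<lambda>(c, \<gamma>) (c', \<gamma>').
     c = c' \<and>
     (\<exists>H p \<phi>. ambient_isotopy H \<and> bij_betw p {..<c} {..<c} \<and>
        (\<forall>i<c. continuous_on UNIV (\<phi> i) \<and> strict_mono (\<phi> i) \<and>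
           (\<forall>t::real. \<phi> i (t + 1) = \<phi> i t + 1) \<and>
           (\<forall>t. H 1 (\<gamma> i t) = \<gamma>' (p i) (\<phi> i t)))))"

text \<open>
  Strands run around the axis \<open>{0} \<times> \<real>\<close> by increasing angle. At rest, strand \<open>j\<close> has distance
  \<open>r = 2\<close> from the axis and height \<open>z = j\<close>. In the crossing \<open>\<sigma>\<^sub>i\<close>, strands \<open>i\<close> and \<open>i + 1\<close>
  exchange places by half a turn about \<open>(2, i + 1/2)\<close> in the \<open>(r, z)\<close> half-plane: seen from far
  outside, with the strands running to the right, the strand going down from \<open>i + 1\<close> to \<open>i\<close> passes
  over the one going up, which is a positive crossing. The result is the pair \<open>(r, z)\<close> at time
  \<open>s \<in> [0, 1]\<close> of the strand starting at place \<open>j\<close>.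
\<close>

definition crossing :: "nat \<times> bool \<Rightarrow> real \<Rightarrow> nat \<Rightarrow> real \<times> real" where
  "crossing = (\<lambda>(i, e) s j.
     let \<epsilon> = (if e then 1 else - 1) in
     if j = i then (2 - \<epsilon> * sin (pi * s) / 2, real i + 1/2 - cos (pi * s) / 2)
     else if j = i + 1 then (2 + \<epsilon> * sin (pi * s) / 2, real i + 1/2 + cos (pi * s) / 2)
     else (2, real j))"

text \<open>
  The full angle is divided into \<open>length w + 1\<close> sectors: one for each letter, and a last one
  in which all strands are at rest, so that the empty word needs no separate treatment.
\<close>

definition closed_braid_set :: "nat \<Rightarrow> braid_word \<Rightarrow> (complex \<times> real) set" where
  "closed_braid_set n w =
     {(rcis r (2 * pi * (real q + s) / real (length w + 1)), z) | r z q s j.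
        q \<le> length w \<and> s \<in> {0..1} \<and> j \<in> {1..n} \<and>
        (r, z) = (if q < length w then crossing (w ! q) s j else (2, real j))}"

text \<open>The link is the closure of the braid word \<open>w\<close>, oriented by increasing angle.\<close>

definition closure_of_word :: "nat \<Rightarrow> braid_word \<Rightarrow> link \<Rightarrow> bool" where
  "closure_of_word n w = (\<lambda>(c, \<gamma>).
     oriented_link (c, \<gamma>) \<and> (\<Union>i<c. range (\<gamma> i)) = closed_braid_set n w \<and>
     (\<forall>i<c. \<exists>\<theta>. continuous_on UNIV \<theta> \<and> strict_mono \<theta> \<and>
        (\<forall>t. fst (\<gamma> i t) = rcis (norm (fst (\<gamma> i t))) (\<theta> t))))"

definition isotopic_to_closure :: "nat \<Rightarrow> braid \<Rightarrow> link \<Rightarrow> bool" where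
  "isotopic_to_closure n \<xi> L \<longleftrightarrow> (\<exists>w\<in>\<xi>. \<exists>L'. closure_of_word n w L' \<and> isotopic L' L)"

text \<open>
  \<open>T\<close> is the invariant of oriented links associated with a function \<open>F\<close> of braids: its value on
  \<open>L\<close> is the value of \<open>F\<close> on any braid whose closure is isotopic to \<open>L\<close>.
\<close>

definition associated_link_invariant :: "(nat \<Rightarrow> braid \<Rightarrow> 'a) \<Rightarrow> (link \<Rightarrow> 'a) \<Rightarrow> bool" where
  "associated_link_invariant F T \<longleftrightarrow>
     (\<forall>n\<ge>1. \<forall>\<xi>\<in>carrier (braid_group n). \<forall>L. oriented_link L \<longrightarrow>
        isotopic_to_closure n \<xi> L \<longrightarrow> T L = F n \<xi>)"

definition skein_triple :: "link \<Rightarrow> link \<Rightarrow> link \<Rightarrow> bool" where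
  "skein_triple Lm L0 Lp \<longleftrightarrow>
     oriented_link Lm \<and> oriented_link L0 \<and> oriented_link Lp \<and>
     (\<exists>n\<ge>2. \<exists>\<xi>\<in>carrier (braid_group n).
        isotopic_to_closure n \<xi> L0 \<and>
        isotopic_to_closure n (sigma n 1 \<otimes>\<^bsub>braid_group n\<^esub> \<xi>) Lp \<and>
        isotopic_to_closure n (inv\<^bsub>braid_group n\<^esub> sigma n 1 \<otimes>\<^bsub>braid_group n\<^esub> \<xi>) Lm)"

text \<open>
  The model is the union of \<open>n\<close> round circles at heights \<open>1, \<dots>, n\<close>; they bound disjoint flat discs.
\<close>

definition trivial_link :: "nat \<Rightarrow> link \<Rightarrow> bool" where
  "trivial_link n L \<longleftrightarrow> oriented_link L \<and>
     isotopic (n, \<lambda>i t. (rcis 2 (2 * pi * t), real (i + 1))) L"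


section \<open>The operator of type (2, 3, 2)\<close>

definition J_mat :: "complex mat" where
  "J_mat = mat_of_rows_list 4
     [[0, 0, 0, 1],
      [0, 0, 1, 0],
      [0, 1, 0, 0],
      [1, 0, 0, 0]]"

definition R_232 :: "complex mat" where
  "R_232 = complex_of_real (1 / sqrt 2) \<cdot>\<^sub>m four_block_mat (1\<^sub>m 4) J_mat (- J_mat) (1\<^sub>m 4)"

end

theory Submission
  imports Defs
begin

text \<open>
  The matrix \<open>R\<close> is a rotation by \<open>\<pi>/4\<close>: with \<open>X\<close> the Pauli matrix and \<open>Y\<close> the quarter turn of the
  plane, \<open>K = Y \<otimes> X \<otimes> X\<close> satisfies \<open>K\<^sup>2 = -1\<close> and \<open>R = (1 + K)/\<surd>2\<close>. Everything follows from this.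

  The copies \<open>K \<otimes> 1 \<otimes> 1\<close> and \<open>1 \<otimes> 1 \<otimes> K\<close> overlap in one factor, where one has \<open>X\<close> and the other \<open>Y\<close>;
  as \<open>X Y = - Y X\<close>, they anticommute. For anticommuting \<open>a\<close> and \<open>b\<close> with square \<open>-1\<close> the product
  \<open>(1 + a)(1 + b)(1 + a)\<close> is \<open>2(a + b)\<close>, which is symmetric in \<open>a\<close> and \<open>b\<close>
  (\<open>braid_product_anticommuting\<close>); this is the Yang-Baxter equation. The inverse of \<open>R\<close> is
  \<open>(1 - K)/\<surd>2\<close>, so \<open>R + R\<^sup>-\<^sup>1 = \<surd>2\<close>, and multiplying this by \<open>\<rho>(\<xi>)\<close> and taking traces gives the skein
  relation (\<open>trace_rho_skein\<close>).

  The trace of \<open>X \<otimes> X\<close> vanishes, so the partial trace of \<open>K\<close> over the last two factors is \<open>0\<close>, and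
  those of \<open>R\<close> and \<open>R\<^sup>-\<^sup>1\<close> are both \<open>4/\<surd>2 = 2\<surd>2 = \<beta>\<close> times the identity. The operators that an enhanced
  operator has to place in \<open>im(\<rho>)\<^sup>\<bottom>\<close> are therefore zero. They also give stabilization: adding a strand
  to \<open>\<xi>\<close> tensors \<open>\<rho>(\<xi>)\<close> with an identity, and the partial trace over the new factors turns the
  additional \<open>R\<close> or \<open>R\<^sup>-\<^sup>1\<close> into the scalar \<open>\<beta>\<close> (\<open>trace_rho_stabilize\<close>). Conjugation invariance is
  cyclicity of the trace.

  The trivial link with \<open>n\<close> components is the closure of the identity of \<open>B\<^sub>n\<close>, whose value is
  \<open>\<beta>\<^sup>-\<^sup>n\<close> times the dimension \<open>2^(2n - 1)\<close> of the tensor power.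
\<close>

section \<open>Kronecker products\<close>

lemma mod_less_of_less_mult: "i < a * b \<Longrightarrow> i mod b < (b::nat)"
  by (cases b) auto

lemmas digit_bounds = less_mult_imp_div_less mod_less_of_less_mult

lemma digits_less: "i < a \<Longrightarrow> j < b \<Longrightarrow> i * b + j < a * (b::nat)"
proof -
  assume "i < a" "j < b"
  then have "i * b + j < Suc i * b" by simp
  also have "\<dots> \<le> a * b" using \<open>i < a\<close> by (intro mult_right_mono) auto
  finally show ?thesis .
qed

lemma digit_div: "l < b \<Longrightarrow> (x * b + l) div b = (x::nat)"
  by (cases "b = 0") simp_all

lemma mod_mult_div: "i mod (b * c) div c = i div c mod (b::nat)"
proof (cases "c = 0")
  case False
  then show ?thesis by (simp add: mult.commute[of b] mod_mult2_eq)
qed simp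

lemma mod_mult_mod: "i mod (b * c) mod c = i mod (c::nat)"
  by (rule mod_mod_cancel) simp

text \<open>
  Positions in a tensor product are pairs of digits \<open>(k div b, k mod b)\<close>, so a sum over positions
  is a double sum over the two factors.
\<close>
lemma sum_div_mod:
  fixes f :: "nat \<Rightarrow> nat \<Rightarrow> 'a::comm_monoid_add"
  shows "(\<Sum>k<a * b. f (k div b) (k mod b)) = (\<Sum>i<a. \<Sum>j<b. f i j)"
proof -
  have "(\<Sum>k<a * b. f (k div b) (k mod b)) = (\<Sum>(i, j)\<in>{..<a} \<times> {..<b}. f i j)"
    by (rule sum.reindex_bij_witness
        [where i = "\<lambda>(i, j). i * b + j" and j = "\<lambda>k. (k div b, k mod b)"])
       (auto simp: digits_less digit_bounds)
  then show ?thesis by (simp add: sum.cartesian_product)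
qed

lemma kron_carrier [simp]:
  "A \<in> carrier_mat a b \<Longrightarrow> B \<in> carrier_mat c e \<Longrightarrow> A \<otimes>\<^sub>K B \<in> carrier_mat (a * c) (b * e)"
  by (simp add: kron_def)

lemma dim_kron [simp]:
  "dim_row (A \<otimes>\<^sub>K B) = dim_row A * dim_row B" "dim_col (A \<otimes>\<^sub>K B) = dim_col A * dim_col B"
  by (simp_all add: kron_def)

lemma index_kron [simp]:
  assumes "i < dim_row A * dim_row B" "j < dim_col A * dim_col B"
  shows "(A \<otimes>\<^sub>K B) $$ (i, j) =
    A $$ (i div dim_row B, j div dim_col B) * B $$ (i mod dim_row B, j mod dim_col B)"
  using assms by (simp add: kron_def)

lemma index_mult_sum:
  "i < dim_row A \<Longrightarrow> j < dim_col B \<Longrightarrow> dim_col A = dim_row B \<Longrightarrow>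
    (A * B) $$ (i, j) = (\<Sum>l<dim_row B. A $$ (i, l) * B $$ (l, j))"
  by (simp add: scalar_prod_def atLeast0LessThan)

lemma kron_mult:
  assumes "dim_col A = dim_row C" "dim_col B = dim_row D"
  shows "(A \<otimes>\<^sub>K B) * (C \<otimes>\<^sub>K D) = (A * C) \<otimes>\<^sub>K (B * D)"
proof (rule eq_matI)
  fix i j
  assume "i < dim_row ((A * C) \<otimes>\<^sub>K (B * D))" "j < dim_col ((A * C) \<otimes>\<^sub>K (B * D))"
  then have i: "i < dim_row A * dim_row B" and j: "j < dim_col C * dim_col D" by simp_all
  let ?i1 = "i div dim_row B" and ?i2 = "i mod dim_row B"
  let ?j1 = "j div dim_col D" and ?j2 = "j mod dim_col D"
  have "((A \<otimes>\<^sub>K B) * (C \<otimes>\<^sub>K D)) $$ (i, j) =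
      (\<Sum>l<dim_row C * dim_row D. (A $$ (?i1, l div dim_row D) * C $$ (l div dim_row D, ?j1)) *
        (B $$ (?i2, l mod dim_row D) * D $$ (l mod dim_row D, ?j2)))"
    using i j assms by (simp add: index_mult_sum mult_ac del: index_mult_mat(1))
  also have "\<dots> = (\<Sum>p<dim_row C. \<Sum>q<dim_row D.
      (A $$ (?i1, p) * C $$ (p, ?j1)) * (B $$ (?i2, q) * D $$ (q, ?j2)))"
    by (rule sum_div_mod)
  also have "\<dots> = ((A * C) \<otimes>\<^sub>K (B * D)) $$ (i, j)"
    using i j assms
    by (simp add: index_mult_sum sum_product digit_bounds del: index_mult_mat(1))
  finally show "((A \<otimes>\<^sub>K B) * (C \<otimes>\<^sub>K D)) $$ (i, j) = ((A * C) \<otimes>\<^sub>K (B * D)) $$ (i, j)" .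
qed simp_all

lemma kron_assoc: "(A \<otimes>\<^sub>K B) \<otimes>\<^sub>K C = A \<otimes>\<^sub>K (B \<otimes>\<^sub>K C)"
proof (rule eq_matI)
  fix i j
  assume "i < dim_row (A \<otimes>\<^sub>K (B \<otimes>\<^sub>K C))" "j < dim_col (A \<otimes>\<^sub>K (B \<otimes>\<^sub>K C))"
  then have "i < dim_row A * dim_row B * dim_row C" "j < dim_col A * dim_col B * dim_col C"
    by (simp_all add: mult.assoc)
  then show "((A \<otimes>\<^sub>K B) \<otimes>\<^sub>K C) $$ (i, j) = (A \<otimes>\<^sub>K (B \<otimes>\<^sub>K C)) $$ (i, j)"
    by (simp add: digit_bounds mult.assoc mod_mult_div mod_mult_mod div_mult2_eq[symmetric]
          mult.commute[of "dim_row C"] mult.commute[of "dim_col C"])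
qed (simp_all add: mult.assoc)

lemma one_kron_one: "1\<^sub>m a \<otimes>\<^sub>K 1\<^sub>m b = 1\<^sub>m (a * b)"
proof (rule eq_matI)
  fix i j assume "i < dim_row (1\<^sub>m (a * b) :: complex mat)" "j < dim_col (1\<^sub>m (a * b) :: complex mat)"
  moreover have "i = j" if "i div b = j div b" "i mod b = j mod b"
    using that by (metis div_mult_mod_eq)
  ultimately show "(1\<^sub>m a \<otimes>\<^sub>K 1\<^sub>m b) $$ (i, j) = 1\<^sub>m (a * b) $$ (i, j)"
    by (auto simp: digit_bounds)
qed simp_all

lemma one_dim_kron [simp]: "1\<^sub>m (Suc 0) \<otimes>\<^sub>K A = A" "A \<otimes>\<^sub>K 1\<^sub>m (Suc 0) = A"
  by (rule eq_matI; simp)+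

lemma kron_add_left:
  "A \<in> carrier_mat a b \<Longrightarrow> B \<in> carrier_mat a b \<Longrightarrow> (A + B) \<otimes>\<^sub>K C = A \<otimes>\<^sub>K C + B \<otimes>\<^sub>K C"
  by (rule eq_matI) (auto simp: digit_bounds distrib_right)

lemma kron_add_right:
  "B \<in> carrier_mat a b \<Longrightarrow> C \<in> carrier_mat a b \<Longrightarrow> A \<otimes>\<^sub>K (B + C) = A \<otimes>\<^sub>K B + A \<otimes>\<^sub>K C"
  by (rule eq_matI) (auto simp: digit_bounds distrib_left)

lemma kron_smult_left: "(c \<cdot>\<^sub>m A) \<otimes>\<^sub>K B = c \<cdot>\<^sub>m (A \<otimes>\<^sub>K B)"
  by (rule eq_matI) (auto simp: digit_bounds)

lemma kron_smult_right: "A \<otimes>\<^sub>K (c \<cdot>\<^sub>m B) = c \<cdot>\<^sub>m (A \<otimes>\<^sub>K B)"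
  by (rule eq_matI) (auto simp: digit_bounds)

lemma smult_smult: "c \<cdot>\<^sub>m (e \<cdot>\<^sub>m A) = (c * e) \<cdot>\<^sub>m (A :: complex mat)"
  by (rule eq_matI) (auto simp: mult.assoc)

lemma one_smult: "1 \<cdot>\<^sub>m A = (A :: complex mat)"
  by (rule eq_matI) auto

lemma tensor_power_one: "tensor_power (1\<^sub>m d) n = 1\<^sub>m (d ^ n)"
  by (induction n) (simp_all add: one_kron_one)

lemma kron_one_mult:
  "dim_col A = dim_row B \<Longrightarrow> (A \<otimes>\<^sub>K 1\<^sub>m c) * (B \<otimes>\<^sub>K 1\<^sub>m c) = (A * B) \<otimes>\<^sub>K 1\<^sub>m c"
  by (simp add: kron_mult)

text \<open>
  If the identity factor has room for \<open>A\<close>, the two copies of \<open>A\<close> act on disjoint tensor factors and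
  both products are \<open>A \<otimes> 1\<^sub>t \<otimes> A\<close>. Thus the commutation axiom of a generalized Yang-Baxter operator is
  automatic when the shift is at least its number of factors.
\<close>
lemma kron_far_commute:
  assumes A: "A \<in> carrier_mat p p"
  shows "(A \<otimes>\<^sub>K 1\<^sub>m (p * t)) * (1\<^sub>m (p * t) \<otimes>\<^sub>K A) = (1\<^sub>m (p * t) \<otimes>\<^sub>K A) * (A \<otimes>\<^sub>K 1\<^sub>m (p * t))"
proof -
  have "A \<otimes>\<^sub>K 1\<^sub>m (p * t) = A \<otimes>\<^sub>K (1\<^sub>m t \<otimes>\<^sub>K 1\<^sub>m p)" by (simp add: one_kron_one mult.commute)
  moreover have "1\<^sub>m (p * t) \<otimes>\<^sub>K A = 1\<^sub>m p \<otimes>\<^sub>K (1\<^sub>m t \<otimes>\<^sub>K A)"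
    by (simp add: one_kron_one[symmetric] kron_assoc)
  ultimately show ?thesis using A by (simp add: kron_mult)
qed

section \<open>Traces and partial traces\<close>

lemma mat_trace_add:
  "A \<in> carrier_mat n n \<Longrightarrow> B \<in> carrier_mat n n \<Longrightarrow> mat_trace (A + B) = mat_trace A + mat_trace B"
  by (simp add: mat_trace_def sum.distrib)

lemma mat_trace_smult:
  "A \<in> carrier_mat n n \<Longrightarrow> mat_trace (c \<cdot>\<^sub>m A) = c * mat_trace A"
  by (simp add: mat_trace_def sum_distrib_left)

lemma mat_trace_one: "mat_trace (1\<^sub>m n) = of_nat n"
  by (simp add: mat_trace_def)

lemma mat_trace_mult_comm:
  assumes "A \<in> carrier_mat n k" "B \<in> carrier_mat k n"
  shows "mat_trace (A * B) = mat_trace (B * A)"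
proof -
  have "mat_trace (A * B) = (\<Sum>i<n. \<Sum>j<k. A $$ (i, j) * B $$ (j, i))"
    using assms by (simp add: mat_trace_def index_mult_sum del: index_mult_mat(1))
  also have "\<dots> = (\<Sum>j<k. \<Sum>i<n. B $$ (j, i) * A $$ (i, j))"
    by (subst sum.swap) (simp add: mult.commute)
  also have "\<dots> = mat_trace (B * A)"
    using assms by (simp add: mat_trace_def index_mult_sum del: index_mult_mat(1))
  finally show ?thesis .
qed

lemma op_trace_carrier [simp]: "op_trace d k m f \<in> carrier_mat (d ^ (k - m)) (d ^ (k - m))"
  by (simp add: op_trace_def)

lemma dim_pow_split: "m \<le> k \<Longrightarrow> d ^ k = d ^ (k - m) * (d::nat) ^ m"
  by (simp flip: power_add)

text \<open>
  Three rules evaluate the trace of a stabilized braid: the trace factors through the partial trace,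
  and the partial trace over the last factors commutes with anything that acts on the other factors
  only, be it a multiplier or an additional tensor factor.
\<close>
lemma mat_trace_op_trace:
  assumes "M \<in> carrier_mat (d ^ k) (d ^ k)" "m \<le> k"
  shows "mat_trace (op_trace d k m M) = mat_trace M"
proof -
  let ?b = "d ^ m"
  have "mat_trace (op_trace d k m M) =
      (\<Sum>i<d ^ (k - m). \<Sum>l<?b. M $$ (i * ?b + l, i * ?b + l))"
    by (simp add: mat_trace_def op_trace_def)
  also have "\<dots> = (\<Sum>p<d ^ (k - m) * ?b.
      M $$ (p div ?b * ?b + p mod ?b, p div ?b * ?b + p mod ?b))"
    by (rule sum_div_mod[symmetric])
  also have "\<dots> = mat_trace M"
    using assms by (simp add: mat_trace_def dim_pow_split div_mult_mod_eq)
  finally show ?thesis .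
qed

lemma op_trace_mult_kron_one:
  assumes A: "A \<in> carrier_mat (d ^ (k - m)) (d ^ (k - m))"
    and M: "M \<in> carrier_mat (d ^ k) (d ^ k)" and "m \<le> k"
  shows "op_trace d k m ((A \<otimes>\<^sub>K 1\<^sub>m (d ^ m)) * M) = A * op_trace d k m M"
proof (rule eq_matI)
  let ?a = "d ^ (k - m)" and ?b = "d ^ m"
  note dk = dim_pow_split[OF \<open>m \<le> k\<close>, of d]
  fix i j
  assume "i < dim_row (A * op_trace d k m M)" "j < dim_col (A * op_trace d k m M)"
  then have i: "i < ?a" and j: "j < ?a" using A by (simp_all add: op_trace_def)
  have entry: "((A \<otimes>\<^sub>K 1\<^sub>m ?b) * M) $$ (i * ?b + l, j * ?b + l) =
      (\<Sum>p<?a. A $$ (i, p) * M $$ (p * ?b + l, j * ?b + l))" if l: "l < ?b" for l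
  proof -
    have "((A \<otimes>\<^sub>K 1\<^sub>m ?b) * M) $$ (i * ?b + l, j * ?b + l) =
        (\<Sum>r<?a * ?b. A $$ (i, r div ?b) * 1\<^sub>m ?b $$ (l, r mod ?b) *
          M $$ (r div ?b * ?b + r mod ?b, j * ?b + l))"
      using A M i j l digits_less[OF i l] digits_less[OF j l]
      by (simp add: index_mult_sum dk div_mult_mod_eq digit_div del: index_mult_mat(1) index_one_mat(1))
    also have "\<dots> = (\<Sum>p<?a. \<Sum>q<?b. A $$ (i, p) * 1\<^sub>m ?b $$ (l, q) *
          M $$ (p * ?b + q, j * ?b + l))"
      by (rule sum_div_mod)
    also have "\<dots> = (\<Sum>p<?a. \<Sum>q<?b. if q = l then A $$ (i, p) * M $$ (p * ?b + l, j * ?b + l) else 0)"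
      using l by (intro sum.cong refl) auto
    finally show ?thesis using l by simp
  qed
  have "op_trace d k m ((A \<otimes>\<^sub>K 1\<^sub>m ?b) * M) $$ (i, j) =
      (\<Sum>l<?b. \<Sum>p<?a. A $$ (i, p) * M $$ (p * ?b + l, j * ?b + l))"
    using i j by (simp add: op_trace_def entry del: index_mult_mat(1))
  also have "\<dots> = (A * op_trace d k m M) $$ (i, j)"
    using A i j by (subst sum.swap)
      (simp add: index_mult_sum op_trace_def sum_distrib_left del: index_mult_mat(1))
  finally show "op_trace d k m ((A \<otimes>\<^sub>K 1\<^sub>m ?b) * M) $$ (i, j) =
      (A * op_trace d k m M) $$ (i, j)" .
qed (use A in \<open>simp_all add: op_trace_def\<close>)

lemma op_trace_one_kron:
  assumes B: "B \<in> carrier_mat (d ^ k) (d ^ k)" and "m \<le> k"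
  shows "op_trace d (a + k) m (1\<^sub>m (d ^ a) \<otimes>\<^sub>K B) = 1\<^sub>m (d ^ a) \<otimes>\<^sub>K op_trace d k m B"
proof (rule eq_matI)
  let ?b = "d ^ m" and ?s = "d ^ (k - m)"
  note dk = dim_pow_split[OF \<open>m \<le> k\<close>, of d]
  \<comment> \<open>The truncated difference needs \<open>m \<le> k\<close>, so that no factor of \<open>1\<close> is traced out.\<close>
  have dak: "d ^ (a + k - m) = d ^ a * ?s"
    using \<open>m \<le> k\<close> by (simp flip: power_add)
  fix i j
  assume "i < dim_row (1\<^sub>m (d ^ a) \<otimes>\<^sub>K op_trace d k m B)"
    "j < dim_col (1\<^sub>m (d ^ a) \<otimes>\<^sub>K op_trace d k m B)"
  then have i: "i < d ^ a * ?s" and j: "j < d ^ a * ?s" by (simp_all add: op_trace_def)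
  have div: "(x * ?b + l) div (?s * ?b) = x div ?s"
    and mod: "(x * ?b + l) mod (?s * ?b) = x mod ?s * ?b + l" if "l < ?b" for x l
    using that by (simp_all add: mult.commute[of ?s] div_mult2_eq mod_mult2_eq digit_div)
  show "op_trace d (a + k) m (1\<^sub>m (d ^ a) \<otimes>\<^sub>K B) $$ (i, j) =
      (1\<^sub>m (d ^ a) \<otimes>\<^sub>K op_trace d k m B) $$ (i, j)"
    using i j B digits_less[OF i, of _ ?b] digits_less[OF j, of _ ?b]
    by (simp add: op_trace_def dak dk div mod digit_bounds mult.assoc sum_distrib_left
          del: index_one_mat(1))
qed (use \<open>m \<le> k\<close> in \<open>simp_all add: op_trace_def flip: power_add\<close>)

lemma op_trace_kron:
  assumes "A \<in> carrier_mat (d ^ (k - m)) (d ^ (k - m))" "B \<in> carrier_mat (d ^ m) (d ^ m)" "m \<le> k"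
  shows "op_trace d k m (A \<otimes>\<^sub>K B) = mat_trace B \<cdot>\<^sub>m A"
  using assms
  by (intro eq_matI)
     (auto simp: op_trace_def mat_trace_def digits_less digit_div sum_distrib_right mult.commute[of "A $$ _"])

lemma op_trace_add:
  assumes "A \<in> carrier_mat (d ^ k) (d ^ k)" "B \<in> carrier_mat (d ^ k) (d ^ k)" "m \<le> k"
  shows "op_trace d k m (A + B) = op_trace d k m A + op_trace d k m B"
  using assms
  by (intro eq_matI) (auto simp: op_trace_def digits_less dim_pow_split sum.distrib)

lemma op_trace_smult:
  assumes "A \<in> carrier_mat (d ^ k) (d ^ k)" "m \<le> k"
  shows "op_trace d k m (c \<cdot>\<^sub>m A) = c \<cdot>\<^sub>m op_trace d k m A"
  using assms
  by (intro eq_matI) (auto simp: op_trace_def digits_less dim_pow_split sum_distrib_left)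

section \<open>Inverse matrices\<close>

lemma mat_inv:
  assumes R: "R \<in> carrier_mat n n" and "invertible_mat R"
  shows "mat_inv R \<in> carrier_mat n n" "R * mat_inv R = 1\<^sub>m n" "mat_inv R * R = 1\<^sub>m n"
proof -
  obtain B where "inverts_mat R B" "inverts_mat B R"
    using \<open>invertible_mat R\<close> by (auto simp: invertible_mat_def)
  then have RB: "R * B = 1\<^sub>m n" "B * R = 1\<^sub>m (dim_row B)"
    using R by (simp_all add: inverts_mat_def)
  have "dim_col B = n" using arg_cong[OF RB(1), of dim_col] by simp
  moreover have "dim_row B = n" using arg_cong[OF RB(2), of dim_col] R by simp
  ultimately have B: "B \<in> carrier_mat n n" by (intro carrier_matI)
  \<comment> \<open>Gauss-Jordan elimination fails only on matrices that are not units.\<close>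
  have "R \<in> Units (ring_mat TYPE(complex) n ())"
    using R B RB by (auto simp: Units_def ring_mat_def intro!: bexI[of _ B])
  with mat_inverse(1)[OF R, of "()"] obtain C where C: "mat_inverse R = Some C" by blast
  from mat_inverse(2)[OF R C] C
  show "mat_inv R \<in> carrier_mat n n" "R * mat_inv R = 1\<^sub>m n" "mat_inv R * R = 1\<^sub>m n"
    by (simp_all add: mat_inv_def)
qed

lemma mat_inv_unique:
  assumes R: "R \<in> carrier_mat n n" and B: "B \<in> carrier_mat n n"
    and RB: "R * B = 1\<^sub>m n" and BR: "B * R = 1\<^sub>m n"
  shows "invertible_mat R" "mat_inv R = B"
proof -
  show inv: "invertible_mat R"
    using assms by (auto simp: invertible_mat_def inverts_mat_def)
  note mi = mat_inv[OF R inv]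
  have "mat_inv R = mat_inv R * (R * B)" using mi RB by simp
  also have "\<dots> = (mat_inv R * R) * B" by (rule assoc_mult_mat[OF mi(1) R B, symmetric])
  also have "\<dots> = B" using mi(3) B by simp
  finally show "mat_inv R = B" .
qed

section \<open>Braid groups\<close>

lemma braid_words_append [simp]:
  "u @ v \<in> braid_words n \<longleftrightarrow> u \<in> braid_words n \<and> v \<in> braid_words n"
  by (auto simp: braid_words_def)

lemma braid_words_Nil [simp]: "[] \<in> braid_words n"
  by (simp add: braid_words_def)

lemma braid_words_Cons [simp]:
  "x # w \<in> braid_words n \<longleftrightarrow> 1 \<le> fst x \<and> fst x < n \<and> w \<in> braid_words n"
  by (cases x) (auto simp: braid_words_def)

lemma braid_eq_words: "braid_eq n u v \<Longrightarrow> u \<in> braid_words n \<and> v \<in> braid_words n"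
  by (induction rule: braid_eq.induct) auto

lemma equiv_braid_rel: "equiv (braid_words n) (braid_rel n)"
  by (rule equivI)
     (auto simp: braid_rel_def refl_on_def sym_def trans_def dest: braid_eq_words
       intro: braid_eq.intros)

lemma braid_eq_Suc: "braid_eq n u v \<Longrightarrow> braid_eq (Suc n) u v"
proof (induction rule: braid_eq.induct)
  case (refl w)
  then show ?case by (intro braid_eq.refl) (auto simp: braid_words_def)
next
  case (braid i)
  then show ?case using braid_eq.braid[of i "Suc n"] by simp
qed (auto intro: braid_eq.intros)

definition braid_of :: "nat \<Rightarrow> braid_word \<Rightarrow> braid" where
  "braid_of n w = braid_rel n `` {w}"

lemma mem_braid_of: "v \<in> braid_of n w \<longleftrightarrow> braid_eq n w v"
  by (simp add: braid_of_def braid_rel_def)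

lemma braid_of_eq_iff:
  "u \<in> braid_words n \<Longrightarrow> v \<in> braid_words n \<Longrightarrow> braid_of n u = braid_of n v \<longleftrightarrow> braid_eq n u v"
  using eq_equiv_class_iff[OF equiv_braid_rel] by (simp add: braid_of_def braid_rel_def)

lemma carrier_braid_group: "carrier (braid_group n) = braid_of n ` braid_words n"
  by (auto simp: braid_group_def quotient_def braid_of_def)

lemma one_braid_group: "\<one>\<^bsub>braid_group n\<^esub> = braid_of n []"
  by (simp add: braid_group_def braid_of_def)

lemma sigma_eq: "sigma n i = braid_of n [(i, True)]"
  by (simp add: sigma_def braid_of_def)

lemma mult_braid_of:
  assumes u: "u \<in> braid_words n" and v: "v \<in> braid_words n"
  shows "braid_of n u \<otimes>\<^bsub>braid_group n\<^esub> braid_of n v = braid_of n (u @ v)"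
proof -
  have "braid_of n u \<otimes>\<^bsub>braid_group n\<^esub> braid_of n v =
      braid_rel n `` {u' @ v' | u' v'. u' \<in> braid_of n u \<and> v' \<in> braid_of n v}"
    by (simp add: braid_group_def)
  also have "\<dots> = braid_of n (u @ v)"
  proof (intro subset_antisym subsetI)
    fix x assume "x \<in> braid_rel n `` {u' @ v' | u' v'. u' \<in> braid_of n u \<and> v' \<in> braid_of n v}"
    then show "x \<in> braid_of n (u @ v)"
      by (auto simp: braid_rel_def mem_braid_of intro: braid_eq.append braid_eq.trans)
  next
    fix x assume "x \<in> braid_of n (u @ v)"
    then show "x \<in> braid_rel n `` {u' @ v' | u' v'. u' \<in> braid_of n u \<and> v' \<in> braid_of n v}"
      using braid_eq.refl[OF u] braid_eq.refl[OF v] by (auto simp: braid_rel_def mem_braid_of)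
  qed
  finally show ?thesis .
qed

definition inverse_word :: "braid_word \<Rightarrow> braid_word" where
  "inverse_word w = rev (map (\<lambda>(i, e). (i, \<not> e)) w)"

lemma inverse_word_in [simp]: "inverse_word w \<in> braid_words n \<longleftrightarrow> w \<in> braid_words n"
  by (induction w) (auto simp: inverse_word_def)

text \<open>
  Cancelling the innermost pair of letters shortens the word.
\<close>
lemma inverse_word_left: "w \<in> braid_words n \<Longrightarrow> braid_eq n (inverse_word w @ w) []"
proof (induction w)
  case Nil
  show ?case by (simp add: inverse_word_def braid_eq.refl)
next
  case (Cons x w)
  obtain i e where x: "x = (i, e)" by (cases x)
  have "braid_eq n [(i, \<not> e), (i, e)] []"
    using Cons.prems braid_eq.cancel[of i n "\<not> e"] by (simp add: x)
  then have "braid_eq n (inverse_word w @ [(i, \<not> e), (i, e)] @ w) (inverse_word w @ [] @ w)"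
    using Cons.prems by (intro braid_eq.append braid_eq.refl) auto
  moreover have "braid_eq n (inverse_word w @ w) []" using Cons by simp
  ultimately show ?case
    by (auto simp: inverse_word_def x intro: braid_eq.trans)
qed

lemma group_braid_group: "group (braid_group n)"
proof (rule groupI)
  fix x assume "x \<in> carrier (braid_group n)"
  then obtain w where w: "w \<in> braid_words n" "x = braid_of n w"
    by (auto simp: carrier_braid_group)
  have "braid_of n (inverse_word w) \<otimes>\<^bsub>braid_group n\<^esub> x = \<one>\<^bsub>braid_group n\<^esub>"
    using w inverse_word_left[of w n] by (simp add: mult_braid_of one_braid_group braid_of_eq_iff)
  then show "\<exists>y\<in>carrier (braid_group n). y \<otimes>\<^bsub>braid_group n\<^esub> x = \<one>\<^bsub>braid_group n\<^esub>"
    using w by (auto simp: carrier_braid_group)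
qed (auto simp: carrier_braid_group one_braid_group mult_braid_of)

lemma inv_braid_of:
  assumes "w \<in> braid_words n"
  shows "inv\<^bsub>braid_group n\<^esub> (braid_of n w) = braid_of n (inverse_word w)"
  using assms inverse_word_left[of w n]
  by (intro group.inv_equality[OF group_braid_group])
     (auto simp: mult_braid_of one_braid_group braid_of_eq_iff carrier_braid_group)

text \<open>
  Every relation of \<open>B\<^sub>n\<close> is a relation of \<open>B\<^sub>n\<^sub>+\<^sub>1\<close>, so adding a strand keeps a representing word.
\<close>
lemma add_strand_braid_of:
  assumes "w \<in> braid_words n"
  shows "add_strand n (braid_of n w) = braid_of (Suc n) w"
  using braid_eq.refl[OF assms]
  by (auto simp: add_strand_def braid_rel_def mem_braid_of
      intro: braid_eq.trans[OF braid_eq_Suc])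

section \<open>The braid group representation of a generalized Yang-Baxter operator\<close>

lemma num_factors_letter:
  "1 \<le> i \<Longrightarrow> i < n \<Longrightarrow> m \<le> k \<Longrightarrow> m * (i - 1) + k + m * (n - i - 1) = num_factors k m n"
proof -
  assume "1 \<le> i" "i < n" "m \<le> k"
  then obtain a b where "i = Suc a" "n = Suc (Suc (a + b))"
    by (metis Suc_diff_1 add_Suc less_imp_Suc_add less_eq_Suc_le One_nat_def)
  with \<open>m \<le> k\<close> show ?thesis by (simp add: num_factors_def algebra_simps)
qed

definition amplify :: "nat \<Rightarrow> nat \<Rightarrow> complex mat \<Rightarrow> complex mat" where
  "amplify a c X = 1\<^sub>m a \<otimes>\<^sub>K X \<otimes>\<^sub>K 1\<^sub>m c"

lemma amplify_carrier [simp]: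
  "X \<in> carrier_mat r s \<Longrightarrow> amplify a c X \<in> carrier_mat (a * r * c) (a * s * c)"
  by (simp add: amplify_def)

lemma amplify_mult:
  "dim_col X = dim_row Y \<Longrightarrow> amplify a c X * amplify a c Y = amplify a c (X * Y)"
  by (simp add: amplify_def kron_mult)

lemma amplify_one: "amplify a c (1\<^sub>m b) = 1\<^sub>m (a * b * c)"
  by (simp add: amplify_def one_kron_one)

lemma amplify_kron_one: "amplify a (b * c) X = amplify a c (X \<otimes>\<^sub>K 1\<^sub>m b)"
  by (simp add: amplify_def one_kron_one[symmetric] kron_assoc)

lemma amplify_one_kron: "amplify (a * b) c X = amplify a c (1\<^sub>m b \<otimes>\<^sub>K X)"
  by (simp add: amplify_def one_kron_one[symmetric] kron_assoc)

lemma rho_letter_amplify: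
  "rho_letter d m R n (i, e) =
    amplify (d ^ (m * (i - 1))) (d ^ (m * (n - i - 1))) (if e then R else mat_inv R)"
  by (simp add: rho_letter_def amplify_def)

text \<open>
  Two letters at distance \<open>s\<close> act on a common window of \<open>k + m s\<close> factors, \<open>R\<close> at its left and at its
  right end; outside the window both are the identity. With \<open>s = 1\<close> this reduces the braid relation,
  and with \<open>s \<ge> 2\<close> far commutation, to the axioms of a generalized Yang-Baxter operator.
\<close>
lemma rho_letter_pair:
  assumes "1 \<le> i" "i + s < n"
  shows "rho_letter d m R n (i, True) = amplify (d ^ (m * (i - 1))) (d ^ (m * (n - (i + s) - 1)))
      (R \<otimes>\<^sub>K 1\<^sub>m (d ^ (m * s)))"
    and "rho_letter d m R n (i + s, True) =
      amplify (d ^ (m * (i - 1))) (d ^ (m * (n - (i + s) - 1))) (1\<^sub>m (d ^ (m * s)) \<otimes>\<^sub>K R)"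
proof -
  have "m * (n - i - 1) = m * s + m * (n - (i + s) - 1)"
    using assms by (simp add: add_mult_distrib2[symmetric])
  then show "rho_letter d m R n (i, True) =
      amplify (d ^ (m * (i - 1))) (d ^ (m * (n - (i + s) - 1))) (R \<otimes>\<^sub>K 1\<^sub>m (d ^ (m * s)))"
    by (simp add: rho_letter_amplify power_add amplify_kron_one)
  have "m * (i + s - 1) = m * (i - 1) + m * s"
    using assms by (simp add: add_mult_distrib2[symmetric])
  then show "rho_letter d m R n (i + s, True) =
      amplify (d ^ (m * (i - 1))) (d ^ (m * (n - (i + s) - 1))) (1\<^sub>m (d ^ (m * s)) \<otimes>\<^sub>K R)"
    by (simp add: rho_letter_amplify power_add amplify_one_kron)
qed

lemma rho_word_Nil [simp]: "rho_word d k m R n [] = 1\<^sub>m (d ^ num_factors k m n)"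
  by (simp add: rho_word_def)

lemma rho_word_Cons [simp]:
  "rho_word d k m R n (x # w) = rho_letter d m R n x * rho_word d k m R n w"
  by (simp add: rho_word_def)

text \<open>
  The inequality makes the number of factors \<open>(k - m) + m (n - 1)\<close> of the representation equal to
  \<open>k + m (n - 2)\<close>, the number on which a generator of \<open>B\<^sub>n\<close> acts.
\<close>
locale gYB =
  fixes d k m :: nat and R :: "complex mat"
  assumes gYB: "gYB_operator d k m R" and m_le_k: "m \<le> k"
begin

lemma R_carrier: "R \<in> carrier_mat (d ^ k) (d ^ k)" and R_invertible: "invertible_mat R"
  using gYB by (auto simp: gYB_operator_def)

lemmas R_inv = mat_inv[OF R_carrier R_invertible]

lemma rho_letter_carrier:
  assumes "1 \<le> fst x" "fst x < n"
  shows "rho_letter d m R n x \<in> carrier_mat (d ^ num_factors k m n) (d ^ num_factors k m n)"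
proof -
  obtain i e where x: "x = (i, e)" by (cases x)
  have "d ^ (m * (i - 1)) * d ^ k * d ^ (m * (n - i - 1)) = d ^ num_factors k m n"
    using num_factors_letter[of i n m k] assms m_le_k by (simp add: x flip: power_add)
  then show ?thesis
    using amplify_carrier[of "if e then R else mat_inv R"] R_carrier R_inv(1)
    by (metis rho_letter_amplify x)
qed

lemma rho_word_carrier:
  "w \<in> braid_words n \<Longrightarrow>
    rho_word d k m R n w \<in> carrier_mat (d ^ num_factors k m n) (d ^ num_factors k m n)"
  by (induction w) (auto intro: mult_carrier_mat[OF rho_letter_carrier])

lemma rho_word_append:
  "u \<in> braid_words n \<Longrightarrow> v \<in> braid_words n \<Longrightarrow>
    rho_word d k m R n (u @ v) = rho_word d k m R n u * rho_word d k m R n v"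
proof (induction u)
  case Nil
  then show ?case using rho_word_carrier[of v n] by simp
next
  case (Cons x u)
  then show ?case
    using assoc_mult_mat[OF rho_letter_carrier[of x n] rho_word_carrier[of u n]
        rho_word_carrier[of v n]]
    by simp
qed

lemma rho_word_singleton:
  "1 \<le> fst x \<Longrightarrow> fst x < n \<Longrightarrow> rho_word d k m R n [x] = rho_letter d m R n x"
  using rho_letter_carrier[of x n] by simp

lemma rho_word_doubleton:
  assumes "1 \<le> fst x" "fst x < n" "1 \<le> fst y" "fst y < n"
  shows "rho_word d k m R n [x, y] = rho_letter d m R n x * rho_letter d m R n y"
  using rho_word_singleton[OF assms(3,4)] by simp

lemma rho_letter_cancel:
  assumes "1 \<le> i" "i < n"
  shows "rho_letter d m R n (i, e) * rho_letter d m R n (i, \<not> e) = 1\<^sub>m (d ^ num_factors k m n)"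
proof -
  have "d ^ (m * (i - 1)) * d ^ k * d ^ (m * (n - i - 1)) = d ^ num_factors k m n"
    using num_factors_letter[of i n m k] assms m_le_k by (simp flip: power_add)
  then show ?thesis
    using R_carrier R_inv by (cases e) (simp_all add: rho_letter_amplify amplify_mult amplify_one)
qed

lemma rho_letter_far:
  assumes "1 \<le> i" "i + 2 \<le> j" "j < n"
  shows "rho_letter d m R n (i, True) * rho_letter d m R n (j, True) =
    rho_letter d m R n (j, True) * rho_letter d m R n (i, True)"
proof -
  define s where "s = j - i"
  have s: "s \<ge> 2" "j = i + s" using assms by (auto simp: s_def)
  let ?I = "1\<^sub>m (d ^ (m * s))"
  have "\<forall>j\<ge>4. (R \<otimes>\<^sub>K 1\<^sub>m (d ^ (m * (j - 2)))) * (1\<^sub>m (d ^ (m * (j - 2))) \<otimes>\<^sub>K R) =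
      (1\<^sub>m (d ^ (m * (j - 2))) \<otimes>\<^sub>K R) * (R \<otimes>\<^sub>K 1\<^sub>m (d ^ (m * (j - 2))))"
    using gYB by (simp add: gYB_operator_def Let_def)
  then have "(R \<otimes>\<^sub>K ?I) * (?I \<otimes>\<^sub>K R) = (?I \<otimes>\<^sub>K R) * (R \<otimes>\<^sub>K ?I)"
    using s(1) by (auto dest!: spec[of _ "s + 2"])
  then show ?thesis
    using rho_letter_pair[of i s n d m R] assms s R_carrier
    by (simp add: amplify_mult mult.commute)
qed

lemma rho_letter_braid:
  assumes "1 \<le> i" "i + 1 < n"
  shows "rho_letter d m R n (i, True) *
      (rho_letter d m R n (i + 1, True) * rho_letter d m R n (i, True)) =
    rho_letter d m R n (i + 1, True) *
      (rho_letter d m R n (i, True) * rho_letter d m R n (i + 1, True))"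
proof -
  let ?I = "1\<^sub>m (d ^ m)"
  have 1: "R \<otimes>\<^sub>K ?I \<in> carrier_mat (d ^ k * d ^ m) (d ^ k * d ^ m)"
    and 2: "?I \<otimes>\<^sub>K R \<in> carrier_mat (d ^ k * d ^ m) (d ^ k * d ^ m)"
    using kron_carrier[OF R_carrier one_carrier_mat, of "d ^ m"]
      kron_carrier[OF one_carrier_mat R_carrier, of "d ^ m"] by (simp_all add: mult.commute)
  have "(R \<otimes>\<^sub>K ?I) * (?I \<otimes>\<^sub>K R) * (R \<otimes>\<^sub>K ?I) = (?I \<otimes>\<^sub>K R) * (R \<otimes>\<^sub>K ?I) * (?I \<otimes>\<^sub>K R)"
    using gYB by (simp add: gYB_operator_def Let_def)
  then have "(R \<otimes>\<^sub>K ?I) * ((?I \<otimes>\<^sub>K R) * (R \<otimes>\<^sub>K ?I)) = (?I \<otimes>\<^sub>K R) * ((R \<otimes>\<^sub>K ?I) * (?I \<otimes>\<^sub>K R))"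
    using assoc_mult_mat[OF 1 2 1] assoc_mult_mat[OF 2 1 2] by simp
  then show ?thesis
    using rho_letter_pair[of i 1 n d m R] assms R_carrier
    by (simp add: amplify_mult mult.commute)
qed

lemma rho_word_braid_eq: "braid_eq n u v \<Longrightarrow> rho_word d k m R n u = rho_word d k m R n v"
proof (induction rule: braid_eq.induct)
  case (append u u' v v')
  then show ?case by (simp add: rho_word_append braid_eq_words)
next
  case (cancel i e)
  then show ?case by (simp only: rho_word_doubleton fst_conv rho_letter_cancel rho_word_Nil)
next
  case (far i j)
  then show ?case using rho_letter_far[of i j n] by (simp only: rho_word_doubleton fst_conv)
next
  case (braid i)
  then show ?case
    using rho_letter_braid[of i n] by (simp only: rho_word_Cons[of _ _ _ _ _ _ "[_, _]"] rho_word_doubleton fst_conv)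
qed auto

text \<open>
  The value on a braid does not depend on the chosen word, because the defining relations of the
  braid group hold for the operators.
\<close>
lemma rho_braid_of: "w \<in> braid_words n \<Longrightarrow> rho d k m R n (braid_of n w) = rho_word d k m R n w"
  unfolding rho_def
  by (rule someI2[of _ w]) (auto simp: mem_braid_of braid_eq.refl dest: rho_word_braid_eq)

lemma rho_carrier:
  "\<xi> \<in> carrier (braid_group n) \<Longrightarrow>
    rho d k m R n \<xi> \<in> carrier_mat (d ^ num_factors k m n) (d ^ num_factors k m n)"
  by (auto simp: carrier_braid_group rho_braid_of rho_word_carrier)

lemma rho_mult:
  "\<xi> \<in> carrier (braid_group n) \<Longrightarrow> \<eta> \<in> carrier (braid_group n) \<Longrightarrow>
    rho d k m R n (\<xi> \<otimes>\<^bsub>braid_group n\<^esub> \<eta>) = rho d k m R n \<xi> * rho d k m R n \<eta>"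
  by (auto simp: carrier_braid_group rho_braid_of mult_braid_of rho_word_append)

lemma rho_one: "rho d k m R n (\<one>\<^bsub>braid_group n\<^esub>) = 1\<^sub>m (d ^ num_factors k m n)"
  by (simp add: one_braid_group rho_braid_of)

lemma rho_sigma:
  assumes "1 \<le> i" "i < n"
  shows "rho d k m R n (sigma n i) = rho_letter d m R n (i, True)"
    and "rho d k m R n (inv\<^bsub>braid_group n\<^esub> sigma n i) = rho_letter d m R n (i, False)"
  using assms
  by (simp_all add: sigma_eq inv_braid_of rho_braid_of inverse_word_def rho_word_singleton del: rho_word_Cons)

lemma num_factors_Suc: "1 \<le> n \<Longrightarrow> num_factors k m (Suc n) = num_factors k m n + m"
  by (cases n) (simp_all add: num_factors_def)

text \<open>
  The new strand contributes \<open>m\<close> tensor factors on the right, on which the old letters act trivially.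
\<close>
lemma rho_word_add_strand:
  assumes "w \<in> braid_words n" "1 \<le> n"
  shows "rho_word d k m R (Suc n) w = rho_word d k m R n w \<otimes>\<^sub>K 1\<^sub>m (d ^ m)"
  using assms(1)
proof (induction w)
  case Nil
  show ?case using assms(2) by (simp add: one_kron_one num_factors_Suc power_add)
next
  case (Cons x w)
  obtain i e where x: "x = (i, e)" by (cases x)
  have "Suc n - i - 1 = Suc (n - i - 1)"
    using Cons.prems by (auto simp: x)
  then have "m * (Suc n - i - 1) = m * (n - i - 1) + m" by simp
  then have "rho_letter d m R (Suc n) x = rho_letter d m R n x \<otimes>\<^sub>K 1\<^sub>m (d ^ m)"
    by (simp add: rho_letter_amplify x amplify_def power_add kron_assoc one_kron_one)
  then show ?case
    using Cons rho_letter_carrier[of x n] rho_word_carrier[of w n]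
    by (simp add: kron_one_mult)
qed

lemma rho_add_strand:
  assumes "\<xi> \<in> carrier (braid_group n)" "1 \<le> n"
  shows "add_strand n \<xi> \<in> carrier (braid_group (Suc n))"
    and "rho d k m R (Suc n) (add_strand n \<xi>) = rho d k m R n \<xi> \<otimes>\<^sub>K 1\<^sub>m (d ^ m)"
proof -
  obtain w where w: "w \<in> braid_words n" "\<xi> = braid_of n w"
    using assms by (auto simp: carrier_braid_group)
  have "w \<in> braid_words (Suc n)" using w(1) by (auto simp: braid_words_def)
  then show "add_strand n \<xi> \<in> carrier (braid_group (Suc n))"
    "rho d k m R (Suc n) (add_strand n \<xi>) = rho d k m R n \<xi> \<otimes>\<^sub>K 1\<^sub>m (d ^ m)"
    using w assms(2)
    by (auto simp: add_strand_braid_of carrier_braid_group rho_braid_of rho_word_add_strand)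
qed

section \<open>Markov moves and the skein relation\<close>

lemma trace_rho_conjugate:
  assumes \<xi>: "\<xi> \<in> carrier (braid_group n)" and \<eta>: "\<eta> \<in> carrier (braid_group n)"
  shows "mat_trace (rho d k m R n (\<eta> \<otimes>\<^bsub>braid_group n\<^esub> \<xi> \<otimes>\<^bsub>braid_group n\<^esub> inv\<^bsub>braid_group n\<^esub> \<eta>)) =
    mat_trace (rho d k m R n \<xi>)"
proof -
  interpret B: group "braid_group n" by (rule group_braid_group)
  have "rho d k m R n (inv\<^bsub>braid_group n\<^esub> \<eta>) * rho d k m R n \<eta> = 1\<^sub>m (d ^ num_factors k m n)"
    using \<eta> by (simp add: rho_mult[symmetric] rho_one)
  note id = this
  note c = rho_carrier[OF \<xi>] rho_carrier[OF \<eta>] rho_carrier[OF B.inv_closed[OF \<eta>]]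
  have "rho d k m R n (\<eta> \<otimes>\<^bsub>braid_group n\<^esub> \<xi> \<otimes>\<^bsub>braid_group n\<^esub> inv\<^bsub>braid_group n\<^esub> \<eta>) =
      rho d k m R n \<eta> * (rho d k m R n \<xi> * rho d k m R n (inv\<^bsub>braid_group n\<^esub> \<eta>))"
    using \<xi> \<eta> c by (simp add: rho_mult)
  also have "mat_trace \<dots> =
      mat_trace (rho d k m R n \<xi> * rho d k m R n (inv\<^bsub>braid_group n\<^esub> \<eta>) * rho d k m R n \<eta>)"
    by (rule mat_trace_mult_comm[OF c(2) mult_carrier_mat[OF c(1,3)]])
  also have "rho d k m R n \<xi> * rho d k m R n (inv\<^bsub>braid_group n\<^esub> \<eta>) * rho d k m R n \<eta> =
      rho d k m R n \<xi>"
    using c by (simp add: id)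
  finally show ?thesis .
qed

text \<open>
  The last generator is \<open>1 \<otimes> R\<close>, and the other letters act trivially on the last \<open>m\<close> factors. The
  partial trace over these factors only sees \<open>R\<close>, which it turns into a scalar.
\<close>
lemma trace_rho_stabilize:
  assumes "1 \<le> n" "\<xi> \<in> carrier (braid_group n)"
    and B: "B = (if e then R else mat_inv R)"
    and Sp: "op_trace d k m B = c \<cdot>\<^sub>m 1\<^sub>m (d ^ (k - m))"
  shows "mat_trace (rho d k m R (Suc n) (add_strand n \<xi>) * rho_letter d m R (Suc n) (n, e)) =
    c * mat_trace (rho d k m R n \<xi>)"
proof -
  let ?K = "num_factors k m (Suc n)" and ?a = "m * (n - 1)"
  have K: "?K = ?a + k" "m \<le> ?K" "?K - m = num_factors k m n"
    using m_le_k assms(1) by (auto simp: num_factors_def) (cases n; simp)+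
  have Bc: "B \<in> carrier_mat (d ^ k) (d ^ k)" using B R_carrier R_inv by simp
  note \<xi>c = rho_carrier[OF assms(2)]
  let ?M = "1\<^sub>m (d ^ ?a) \<otimes>\<^sub>K B"
  have M: "?M \<in> carrier_mat (d ^ ?K) (d ^ ?K)"
    using Bc by (simp add: K power_add)
  have letter: "rho_letter d m R (Suc n) (n, e) = ?M"
    by (simp add: rho_letter_amplify amplify_def B)
  have \<xi>1: "rho d k m R n \<xi> \<otimes>\<^sub>K 1\<^sub>m (d ^ m) \<in> carrier_mat (d ^ ?K) (d ^ ?K)"
    using kron_carrier[OF \<xi>c one_carrier_mat, of "d ^ m"] by (simp add: dim_pow_split[OF K(2)] K(3))
  have nf: "num_factors k m n = ?a + (k - m)" by (simp add: num_factors_def)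
  have "mat_trace (rho d k m R (Suc n) (add_strand n \<xi>) * rho_letter d m R (Suc n) (n, e)) =
      mat_trace (op_trace d ?K m ((rho d k m R n \<xi> \<otimes>\<^sub>K 1\<^sub>m (d ^ m)) * ?M))"
    using mat_trace_op_trace[OF mult_carrier_mat[OF \<xi>1 M] K(2)] assms(1,2)
    by (simp add: rho_add_strand letter)
  also have "\<dots> = mat_trace (rho d k m R n \<xi> * op_trace d ?K m ?M)"
    using M \<xi>c K by (subst op_trace_mult_kron_one) auto
  also have "op_trace d ?K m ?M = c \<cdot>\<^sub>m 1\<^sub>m (d ^ num_factors k m n)"
    unfolding K(1) using op_trace_one_kron[OF Bc m_le_k, of ?a] Sp
    by (simp add: kron_smult_right one_kron_one nf power_add)
  also have "rho d k m R n \<xi> * \<dots> = c \<cdot>\<^sub>m rho d k m R n \<xi>"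
    using \<xi>c by (simp add: mult_smult_distrib[OF \<xi>c one_carrier_mat])
  finally show ?thesis using \<xi>c by (simp add: mat_trace_smult)
qed

text \<open>
  For \<open>\<alpha> = 1\<close> the writhe drops out of \<open>T\<close>. The factor \<open>\<beta>\<close> from the partial trace in a stabilization
  is compensated by the change of \<open>\<beta>\<^sup>-\<^sup>n\<close>.
\<close>
lemma markov_invariant_T_braid:
  assumes Sp: "op_trace d k m R = \<beta> \<cdot>\<^sub>m 1\<^sub>m (d ^ (k - m))"
    "op_trace d k m (mat_inv R) = \<beta> \<cdot>\<^sub>m 1\<^sub>m (d ^ (k - m))"
    and "\<beta> \<noteq> 0"
  shows "markov_invariant (T_braid d k m (R, 1\<^sub>m d, 1, \<beta>))"
proof -
  have T: "T_braid d k m (R, 1\<^sub>m d, 1, \<beta>) n \<xi> = \<beta> powi (- int n) * mat_trace (rho d k m R n \<xi>)"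
    if "\<xi> \<in> carrier (braid_group n)" for n \<xi>
    using rho_carrier[OF that] by (simp add: T_braid_def tensor_power_one)
  have pow: "\<beta> powi (- int (Suc n)) * (\<beta> * x) = \<beta> powi (- int n) * x" for n x
    using \<open>\<beta> \<noteq> 0\<close> by (simp add: power_int_minus field_simps del: of_nat_Suc)
  show ?thesis
    unfolding markov_invariant_def
  proof (intro allI impI ballI conjI)
    fix n \<xi> assume n: "(1::nat) \<le> n" and \<xi>: "\<xi> \<in> carrier (braid_group n)"
    interpret B: group "braid_group n" by (rule group_braid_group)
    interpret B': group "braid_group (Suc n)" by (rule group_braid_group)
    have s: "sigma (Suc n) n \<in> carrier (braid_group (Suc n))"
      using n by (simp add: sigma_eq carrier_braid_group)
    note add = rho_add_strand[OF \<xi> n]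
    show "T_braid d k m (R, 1\<^sub>m d, 1, \<beta>) n
        (\<eta> \<otimes>\<^bsub>braid_group n\<^esub> \<xi> \<otimes>\<^bsub>braid_group n\<^esub> inv\<^bsub>braid_group n\<^esub> \<eta>) =
      T_braid d k m (R, 1\<^sub>m d, 1, \<beta>) n \<xi>" if "\<eta> \<in> carrier (braid_group n)" for \<eta>
      using that \<xi> by (simp add: T trace_rho_conjugate)
    show "T_braid d k m (R, 1\<^sub>m d, 1, \<beta>) (Suc n)
        (add_strand n \<xi> \<otimes>\<^bsub>braid_group (Suc n)\<^esub> sigma (Suc n) n) =
      T_braid d k m (R, 1\<^sub>m d, 1, \<beta>) n \<xi>"
      using trace_rho_stabilize[OF n \<xi> _ Sp(1), of True] add(1) s n \<xi>
      by (simp add: T rho_mult rho_sigma pow del: power_int_minus of_nat_Suc)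
    show "T_braid d k m (R, 1\<^sub>m d, 1, \<beta>) (Suc n)
        (add_strand n \<xi> \<otimes>\<^bsub>braid_group (Suc n)\<^esub> inv\<^bsub>braid_group (Suc n)\<^esub> sigma (Suc n) n) =
      T_braid d k m (R, 1\<^sub>m d, 1, \<beta>) n \<xi>"
      using trace_rho_stabilize[OF n \<xi> _ Sp(2), of False] add(1) s n \<xi>
      by (simp add: T rho_mult rho_sigma pow del: power_int_minus of_nat_Suc)
  qed
qed

text \<open>
  Scalar partial traces make the operators that have to be orthogonal to the image of \<open>\<rho>\<close> vanish.
\<close>
lemma EgYB_operator_identity:
  assumes "0 < m" "m < k" "\<alpha> \<noteq> 0" "\<beta> \<noteq> 0"
    and Sp: "op_trace d k m R = (\<alpha> * \<beta>) \<cdot>\<^sub>m 1\<^sub>m (d ^ (k - m))"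
      "op_trace d k m (mat_inv R) = (inverse \<alpha> * \<beta>) \<cdot>\<^sub>m 1\<^sub>m (d ^ (k - m))"
  shows "EgYB_operator d k m (R, 1\<^sub>m d, \<alpha>, \<beta>)"
proof -
  have zero: "1\<^sub>m (d ^ (m * (n - 1))) \<otimes>\<^sub>K (c \<cdot>\<^sub>m 1\<^sub>m (d ^ (k - m)) - c \<cdot>\<^sub>m 1\<^sub>m (d ^ (k - m)))
      \<in> perp (d ^ num_factors k m n) (rho d k m R n ` carrier (braid_group n))" for n c
  proof -
    let ?N = "d ^ num_factors k m n"
    have N: "d ^ (m * (n - 1)) * d ^ (k - m) = ?N"
      by (simp add: num_factors_def add.commute flip: power_add)
    have "1\<^sub>m (d ^ (m * (n - 1))) \<otimes>\<^sub>K (c \<cdot>\<^sub>m 1\<^sub>m (d ^ (k - m)) - c \<cdot>\<^sub>m 1\<^sub>m (d ^ (k - m))) = 0\<^sub>m ?N ?N"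
    proof -
      have "c \<cdot>\<^sub>m 1\<^sub>m (d ^ (k - m)) - c \<cdot>\<^sub>m 1\<^sub>m (d ^ (k - m)) = 0\<^sub>m (d ^ (k - m)) (d ^ (k - m))"
        by (intro eq_matI) auto
      moreover have "1\<^sub>m (d ^ (m * (n - 1))) \<otimes>\<^sub>K 0\<^sub>m (d ^ (k - m)) (d ^ (k - m)) = 0\<^sub>m ?N ?N"
        unfolding N[symmetric] by (intro eq_matI) (auto simp: digit_bounds)
      ultimately show ?thesis by (simp only:)
    qed
    moreover have "mat_trace (mat_adjoint (rho d k m R n \<xi>) * 0\<^sub>m ?N ?N) = 0"
      if "\<xi> \<in> carrier (braid_group n)" for \<xi>
    proof -
      have "mat_adjoint (rho d k m R n \<xi>) \<in> carrier_mat ?N ?N"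
        using rho_carrier[OF that] by (intro carrier_matI) (auto simp: mat_adjoint_def)
      then show ?thesis by (simp add: mat_trace_def)
    qed
    ultimately show ?thesis by (auto simp: perp_def)
  qed
  show ?thesis
    using assms gYB R_carrier R_inv(1) zero
    by (simp add: EgYB_operator_def tensor_power_one Let_def)
qed

text \<open>
  A quadratic relation \<open>R + R\<^sup>-\<^sup>1 = c\<close> passes to each generator of the braid group, since tensoring
  with identities is linear; it is then multiplied by \<open>\<rho>(\<xi>)\<close> under the trace.
\<close>
lemma trace_rho_skein:
  assumes sum: "R + mat_inv R = c \<cdot>\<^sub>m 1\<^sub>m (d ^ k)" and i: "1 \<le> i" "i < n"
    and \<xi>: "\<xi> \<in> carrier (braid_group n)"
  shows "mat_trace (rho d k m R n (sigma n i \<otimes>\<^bsub>braid_group n\<^esub> \<xi>)) +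
      mat_trace (rho d k m R n (inv\<^bsub>braid_group n\<^esub> sigma n i \<otimes>\<^bsub>braid_group n\<^esub> \<xi>)) =
    c * mat_trace (rho d k m R n \<xi>)"
proof -
  interpret B: group "braid_group n" by (rule group_braid_group)
  let ?N = "d ^ num_factors k m n"
  let ?P = "rho_letter d m R n (i, True)" and ?Q = "rho_letter d m R n (i, False)"
  have s: "sigma n i \<in> carrier (braid_group n)"
    using i by (simp add: sigma_eq carrier_braid_group)
  have P: "?P \<in> carrier_mat ?N ?N" and Q: "?Q \<in> carrier_mat ?N ?N"
    using rho_letter_carrier[of "(i, _)" n] i by auto
  have dims: "d ^ (m * (i - 1)) * d ^ k * d ^ (m * (n - i - 1)) = ?N"
    using num_factors_letter[of i n m k] i m_le_k by (simp flip: power_add)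
  have PQ: "?P + ?Q = c \<cdot>\<^sub>m 1\<^sub>m ?N"
  proof -
    have "?P + ?Q = amplify (d ^ (m * (i - 1))) (d ^ (m * (n - i - 1))) (R + mat_inv R)"
      using R_carrier R_inv(1)
      by (simp add: rho_letter_amplify amplify_def kron_add_right[of _ "d ^ k" "d ^ k"]
          kron_add_left[OF kron_carrier[OF one_carrier_mat R_carrier] kron_carrier[OF one_carrier_mat R_inv(1)]])
    also have "\<dots> = c \<cdot>\<^sub>m 1\<^sub>m ?N"
      unfolding sum using dims
      by (simp add: amplify_def kron_smult_left kron_smult_right one_kron_one)
    finally show ?thesis .
  qed
  note \<xi>c = rho_carrier[OF \<xi>]
  have "mat_trace (?P * rho d k m R n \<xi>) + mat_trace (?Q * rho d k m R n \<xi>) =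
      mat_trace ((?P + ?Q) * rho d k m R n \<xi>)"
    using add_mult_distrib_mat[OF P Q \<xi>c] mat_trace_add[OF mult_carrier_mat[OF P \<xi>c] mult_carrier_mat[OF Q \<xi>c]]
    by simp
  also have "\<dots> = c * mat_trace (rho d k m R n \<xi>)"
    using \<xi>c by (simp add: PQ mult_smult_assoc_mat[OF one_carrier_mat \<xi>c] mat_trace_smult)
  finally show ?thesis using \<xi> s i by (simp add: rho_mult rho_sigma)
qed

end

section \<open>The operator of type (2, 3, 2) as a rotation\<close>

text \<open>
  Expanding gives \<open>1 + 2a + b + a\<^sup>2 + (ab + ba) + aba\<close>. Here \<open>a\<^sup>2 = -1\<close> cancels the \<open>1\<close>, anticommutation
  kills the bracket, and \<open>aba = - a\<^sup>2 b = b\<close>. The result is symmetric in \<open>a\<close> and \<open>b\<close>, so if \<open>b\<^sup>2 = -1\<close>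
  as well, \<open>1 + a\<close> and \<open>1 + b\<close> satisfy the braid relation.
\<close>
lemma braid_product_anticommuting:
  fixes a b :: "complex mat"
  assumes a: "a \<in> carrier_mat n n" and b: "b \<in> carrier_mat n n"
    and aa: "a * a = (-1) \<cdot>\<^sub>m 1\<^sub>m n" and ba: "b * a = (-1) \<cdot>\<^sub>m (a * b)"
  shows "(1\<^sub>m n + a) * (1\<^sub>m n + b) * (1\<^sub>m n + a) = 2 \<cdot>\<^sub>m (a + b)"
proof -
  let ?I = "1\<^sub>m n :: complex mat"
  have ab: "a * b \<in> carrier_mat n n" using a b by simp
  have "a * b * a = a * ((-1) \<cdot>\<^sub>m (a * b))"
    using assoc_mult_mat[OF a b a] by (simp add: ba)
  also have "\<dots> = (-1) \<cdot>\<^sub>m (a * a * b)"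
    using mult_smult_distrib[OF a ab] assoc_mult_mat[OF a a b] by simp
  also have "\<dots> = b"
    using b by (simp add: aa) (intro eq_matI, auto)
  finally have aba: "a * b * a = b" .
  have expand: "(?I + a) * (?I + b) = ?I + a + (b + a * b)"
    using a b ab by (simp add: mult_add_distrib_mat[of _ n n _ n] add_mult_distrib_mat[of _ n n _ _ n])
  have "(?I + a) * (?I + b) * (?I + a) = (?I + a + (b + a * b)) + (a + a * a + (b * a + a * b * a))"
    unfolding expand using a b ab by (simp add: mult_add_distrib_mat[of _ n n _ n] add_mult_distrib_mat[of _ n n _ _ n])
  also have "\<dots> = 2 \<cdot>\<^sub>m (a + b)"
    unfolding aba unfolding aa ba using a b ab
    by (intro eq_matI) (auto simp del: index_mult_mat(1))
  finally show ?thesis .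
qed

definition pauli_X :: "complex mat" where
  "pauli_X = mat 2 2 (\<lambda>(i, j). if i = j then 0 else 1)"

definition quarter_turn :: "complex mat" where
  "quarter_turn = mat 2 2 (\<lambda>(i, j). if i = j then 0 else if i < j then 1 else - 1)"

lemma pauli_X_quarter_turn_carrier [simp]: "pauli_X \<in> carrier_mat 2 2" "quarter_turn \<in> carrier_mat 2 2"
  by (simp_all add: pauli_X_def quarter_turn_def)

lemma pauli_X_quarter_turn_dim [simp]:
  "dim_row pauli_X = 2" "dim_col pauli_X = 2" "dim_row quarter_turn = 2" "dim_col quarter_turn = 2"
  using pauli_X_quarter_turn_carrier by (blast dest: carrier_matD)+

lemma pauli_X_quarter_turn_mult:
  "pauli_X * pauli_X = 1\<^sub>m 2" "quarter_turn * quarter_turn = (-1) \<cdot>\<^sub>m 1\<^sub>m 2" "pauli_X * quarter_turn = (-1) \<cdot>\<^sub>m (quarter_turn * pauli_X)"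
  by (rule eq_matI; auto simp: pauli_X_def quarter_turn_def scalar_prod_def less_2_cases_iff numeral_2_eq_2)+

lemma J_eq_kron: "J_mat = pauli_X \<otimes>\<^sub>K pauli_X"
proof (rule eq_matI)
  fix i j assume "i < dim_row (pauli_X \<otimes>\<^sub>K pauli_X)" "j < dim_col (pauli_X \<otimes>\<^sub>K pauli_X)"
  then have "i \<in> {0, 1, 2, 3}" "j \<in> {0, 1, 2, 3}" by auto
  then show "J_mat $$ (i, j) = (pauli_X \<otimes>\<^sub>K pauli_X) $$ (i, j)"
    by (auto simp: J_mat_def pauli_X_def kron_def mat_of_rows_list_def)
qed (simp_all add: J_mat_def mat_of_rows_list_def)

lemma J_dim [simp]: "dim_row J_mat = 4" "dim_col J_mat = 4"
  by (simp_all add: J_mat_def mat_of_rows_list_def)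

lemma J_carrier [simp]: "J_mat \<in> carrier_mat 4 4"
  by (intro carrier_matI) simp_all

lemma J_trace: "mat_trace J_mat = 0"
  by (simp add: mat_trace_def J_mat_def mat_of_rows_list_def numeral_eq_Suc)

text \<open>
  The operator \<open>K\<close>, the infinitesimal generator of the rotation: since its square is \<open>-1\<close>, its exponential at angle
  \<open>\<pi>/4\<close> is \<open>cos (\<pi>/4) + sin (\<pi>/4) K\<close>, which is \<open>R\<close>.
\<close>
definition rot_gen :: "complex mat" where
  "rot_gen = quarter_turn \<otimes>\<^sub>K J_mat"

lemma rot_gen_carrier [simp]: "rot_gen \<in> carrier_mat 8 8"
  using kron_carrier[OF pauli_X_quarter_turn_carrier(2) J_carrier] by (simp add: rot_gen_def)

lemma rot_gen_dim [simp]: "dim_row rot_gen = 8" "dim_col rot_gen = 8"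
  using carrier_matD[OF rot_gen_carrier] by simp_all

lemma R_232_eq_rotation: "R_232 = complex_of_real (1 / sqrt 2) \<cdot>\<^sub>m (1\<^sub>m 8 + rot_gen)"
proof -
  have "four_block_mat (1\<^sub>m 4) J_mat (- J_mat) (1\<^sub>m 4) = 1\<^sub>m 8 + rot_gen"
  proof (rule eq_matI)
    fix i j assume "i < dim_row (1\<^sub>m 8 + rot_gen)" "j < dim_col (1\<^sub>m 8 + rot_gen)"
    then have ij: "i < 8" "j < 8" using rot_gen_carrier by auto
    \<comment> \<open>The leading binary digit of a position selects the block.\<close>
    have digits: "l div 4 = (if l < 4 then 0 else 1) \<and> l mod 4 = (if l < 4 then l else l - 4)"
      if "l < 8" for l :: nat
      using that by (auto simp: div_nat_eqI le_mod_geq)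
    show "four_block_mat (1\<^sub>m 4) J_mat (- J_mat) (1\<^sub>m 4) $$ (i, j) = (1\<^sub>m 8 + rot_gen) $$ (i, j)"
      using ij digits[OF ij(1)] digits[OF ij(2)]
      by (auto simp: rot_gen_def kron_def quarter_turn_def)
  qed simp_all
  then show ?thesis by (simp add: R_232_def)
qed

lemma rot_gen_square: "rot_gen * rot_gen = (-1) \<cdot>\<^sub>m 1\<^sub>m 8"
  by (simp add: rot_gen_def J_eq_kron kron_mult pauli_X_quarter_turn_mult kron_smult_left one_kron_one)

text \<open>
  The two copies meet in the third of five factors, where the product is \<open>X Y\<close> in one order and
  \<open>Y X = - X Y\<close> in the other; in the remaining factors one of them is the identity.
\<close>
lemma rot_gen_anticommute:
  "(1\<^sub>m 4 \<otimes>\<^sub>K rot_gen) * (rot_gen \<otimes>\<^sub>K 1\<^sub>m 4) = (-1) \<cdot>\<^sub>m ((rot_gen \<otimes>\<^sub>K 1\<^sub>m 4) * (1\<^sub>m 4 \<otimes>\<^sub>K rot_gen))"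
proof -
  have 1: "rot_gen \<otimes>\<^sub>K 1\<^sub>m 4 = (quarter_turn \<otimes>\<^sub>K pauli_X) \<otimes>\<^sub>K (pauli_X \<otimes>\<^sub>K 1\<^sub>m 4)"
    by (simp add: rot_gen_def J_eq_kron kron_assoc)
  have 2: "1\<^sub>m 4 \<otimes>\<^sub>K rot_gen = 1\<^sub>m 4 \<otimes>\<^sub>K (quarter_turn \<otimes>\<^sub>K J_mat)"
    by (simp add: rot_gen_def)
  show ?thesis
    unfolding 1 2
    by (simp add: kron_mult pauli_X_quarter_turn_mult(3)) (simp add: kron_smult_left kron_smult_right J_eq_kron kron_mult smult_smult one_smult)
qed

definition R_232_inv :: "complex mat" where
  "R_232_inv = complex_of_real (1 / sqrt 2) \<cdot>\<^sub>m (1\<^sub>m 8 + (-1) \<cdot>\<^sub>m rot_gen)"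

lemma sqrt2_square: "complex_of_real (sqrt 2) * complex_of_real (sqrt 2) = 2"
  by (simp flip: of_real_mult)

lemma R_232_carrier [simp]: "R_232 \<in> carrier_mat 8 8"
  by (simp add: R_232_eq_rotation)

lemma R_232_inv_carrier: "R_232_inv \<in> carrier_mat 8 8"
  by (simp add: R_232_inv_def)

lemma R_232_mult_inv: "R_232 * R_232_inv = 1\<^sub>m 8" "R_232_inv * R_232 = 1\<^sub>m 8"
proof -
  let ?Z' = "(-1) \<cdot>\<^sub>m rot_gen"
  have Z': "?Z' \<in> carrier_mat 8 8" by simp
  have ZZ': "rot_gen * ?Z' = 1\<^sub>m 8" "?Z' * rot_gen = 1\<^sub>m 8"
    using mult_smult_distrib[OF rot_gen_carrier rot_gen_carrier, of "-1"]
      mult_smult_assoc_mat[OF rot_gen_carrier rot_gen_carrier, of "-1"]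
    by (auto simp: rot_gen_square intro!: eq_matI)
  have scale: "complex_of_real (1 / sqrt 2) \<cdot>\<^sub>m A * (complex_of_real (1 / sqrt 2) \<cdot>\<^sub>m B) = 1\<^sub>m 8"
    if A: "A \<in> carrier_mat 8 8" and B: "B \<in> carrier_mat 8 8" and AB: "A * B = 2 \<cdot>\<^sub>m 1\<^sub>m 8" for A B
    using mult_smult_assoc_mat[OF A smult_carrier_mat[OF B]] mult_smult_distrib[OF A B] AB
    by (auto simp: sqrt2_square intro!: eq_matI)
  note distrib = mult_add_distrib_mat[of _ 8 8 _ 8] add_mult_distrib_mat[of _ 8 8 _ _ 8]
    left_mult_one_mat[of _ 8 8] right_mult_one_mat[of _ 8 8]
  have "(1\<^sub>m 8 + rot_gen) * (1\<^sub>m 8 + ?Z') = 2 \<cdot>\<^sub>m 1\<^sub>m 8"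
    using ZZ' Z' by (simp add: distrib) (auto intro!: eq_matI)
  then show "R_232 * R_232_inv = 1\<^sub>m 8"
    unfolding R_232_eq_rotation R_232_inv_def by (intro scale) auto
  have "(1\<^sub>m 8 + ?Z') * (1\<^sub>m 8 + rot_gen) = 2 \<cdot>\<^sub>m 1\<^sub>m 8"
    using ZZ' Z' by (simp add: distrib) (auto intro!: eq_matI)
  then show "R_232_inv * R_232 = 1\<^sub>m 8"
    unfolding R_232_eq_rotation R_232_inv_def by (intro scale) auto
qed

lemmas R_232_inverse = mat_inv_unique[OF R_232_carrier R_232_inv_carrier R_232_mult_inv]

lemma R_232_add_inverse: "R_232 + mat_inv R_232 = complex_of_real (sqrt 2) \<cdot>\<^sub>m 1\<^sub>m 8"
  unfolding R_232_inverse(2) unfolding R_232_eq_rotation R_232_inv_def using rot_gen_carrier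
  by (intro eq_matI) (auto simp: field_simps sqrt2_square)

lemma gYB_R_232: "gYB_operator 2 3 2 R_232"
proof -
  let ?c = "complex_of_real (1 / sqrt 2)"
  let ?a = "rot_gen \<otimes>\<^sub>K 1\<^sub>m 4" and ?b = "1\<^sub>m 4 \<otimes>\<^sub>K rot_gen" and ?I = "1\<^sub>m 32 :: complex mat"
  have a: "?a \<in> carrier_mat 32 32" and b: "?b \<in> carrier_mat 32 32"
    using kron_carrier[OF rot_gen_carrier one_carrier_mat, of 4]
      kron_carrier[OF one_carrier_mat rot_gen_carrier, of 4] by simp_all
  have Ia: "?I + ?a \<in> carrier_mat 32 32" and Ib: "?I + ?b \<in> carrier_mat 32 32"
    using a b by auto
  have R1: "R_232 \<otimes>\<^sub>K 1\<^sub>m 4 = ?c \<cdot>\<^sub>m (?I + ?a)" and R2: "1\<^sub>m 4 \<otimes>\<^sub>K R_232 = ?c \<cdot>\<^sub>m (?I + ?b)"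
    unfolding R_232_eq_rotation using rot_gen_carrier
    by (simp_all add: kron_smult_left kron_smult_right kron_add_left[of _ 8 8]
        kron_add_right[of _ 8 8] one_kron_one)
  have scale: "?c \<cdot>\<^sub>m A * (?c \<cdot>\<^sub>m B) * (?c \<cdot>\<^sub>m A) = ?c ^ 3 \<cdot>\<^sub>m (A * B * A)"
    if A: "A \<in> carrier_mat 32 32" and B: "B \<in> carrier_mat 32 32" for A B
    using A B
    by (simp add: mult_smult_assoc_mat[of _ 32 32 _ 32] mult_smult_distrib[of _ 32 32 _ 32]
        power3_eq_cube smult_smult mult.assoc)
  have aa: "?a * ?a = (-1) \<cdot>\<^sub>m ?I" and bb: "?b * ?b = (-1) \<cdot>\<^sub>m ?I"
    using rot_gen_carrier
    by (simp_all add: kron_mult rot_gen_square kron_smult_left kron_smult_right one_kron_one)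
  have ab: "?a * ?b = (-1) \<cdot>\<^sub>m (?b * ?a)"
    using a b by (simp add: rot_gen_anticommute) (intro eq_matI, auto simp del: index_mult_mat(1))
  have YB: "(R_232 \<otimes>\<^sub>K 1\<^sub>m 4) * (1\<^sub>m 4 \<otimes>\<^sub>K R_232) * (R_232 \<otimes>\<^sub>K 1\<^sub>m 4) =
      (1\<^sub>m 4 \<otimes>\<^sub>K R_232) * (R_232 \<otimes>\<^sub>K 1\<^sub>m 4) * (1\<^sub>m 4 \<otimes>\<^sub>K R_232)"
    unfolding R1 R2 scale[OF Ia Ib] scale[OF Ib Ia]
      braid_product_anticommuting[OF a b aa rot_gen_anticommute] braid_product_anticommuting[OF b a bb ab]
    using comm_add_mat[OF a b] by simp
  have far: "(R_232 \<otimes>\<^sub>K 1\<^sub>m (2 ^ (2 * (j - 2)))) * (1\<^sub>m (2 ^ (2 * (j - 2))) \<otimes>\<^sub>K R_232) =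
      (1\<^sub>m (2 ^ (2 * (j - 2))) \<otimes>\<^sub>K R_232) * (R_232 \<otimes>\<^sub>K 1\<^sub>m (2 ^ (2 * (j - 2))))" if "4 \<le> j" for j
  proof -
    have "2 ^ (2 * (j - 2)) = 8 * (2::nat) ^ (2 * (j - 4) + 1)"
    proof -
      \<comment> \<open>The shift by \<open>2 (j - 2) \<ge> 4\<close> factors clears the three factors on which \<open>R\<close> acts.\<close>
      have "2 * (j - 2) = 3 + (2 * (j - 4) + 1)" using that by simp
      then show ?thesis by (simp only: power_add) simp
    qed
    then show ?thesis using kron_far_commute[OF R_232_carrier] by metis
  qed
  show ?thesis
    using YB far R_232_inverse(1) by (simp add: gYB_operator_def)
qed

text \<open>
  Splitting off the first factor, the identity has partial trace \<open>tr 1\<^sub>4 = 4\<close> and \<open>Y \<otimes> J\<close> has partial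
  trace \<open>(tr J) Y = 0\<close>. The sign of \<open>K\<close> is therefore invisible, which is why \<open>R\<close> and its inverse have
  the same partial trace and \<open>\<alpha> = 1\<close>.
\<close>
lemma op_trace_R_232:
  "op_trace 2 3 2 R_232 = (2 * complex_of_real (sqrt 2)) \<cdot>\<^sub>m 1\<^sub>m (2 ^ (3 - 2))"
  "op_trace 2 3 2 (mat_inv R_232) = (2 * complex_of_real (sqrt 2)) \<cdot>\<^sub>m 1\<^sub>m (2 ^ (3 - 2))"
proof -
  have Z: "op_trace 2 3 2 rot_gen = 0 \<cdot>\<^sub>m quarter_turn"
    unfolding rot_gen_def using op_trace_kron[of quarter_turn 2 3 2 J_mat] J_trace by simp
  have I: "op_trace 2 3 2 (1\<^sub>m 8) = 4 \<cdot>\<^sub>m 1\<^sub>m 2"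
    using op_trace_kron[of "1\<^sub>m 2" 2 3 2 "1\<^sub>m 4"] by (simp add: one_kron_one mat_trace_one)
  have *: "complex_of_real (1 / sqrt 2) * 4 = 2 * complex_of_real (sqrt 2)"
    by (simp add: field_simps sqrt2_square)
  show "op_trace 2 3 2 R_232 = (2 * complex_of_real (sqrt 2)) \<cdot>\<^sub>m 1\<^sub>m (2 ^ (3 - 2))"
    unfolding R_232_eq_rotation
    by (subst op_trace_smult, simp, simp, subst op_trace_add)
       (auto simp: Z I *[simplified] intro!: eq_matI)
  show "op_trace 2 3 2 (mat_inv R_232) = (2 * complex_of_real (sqrt 2)) \<cdot>\<^sub>m 1\<^sub>m (2 ^ (3 - 2))"
    unfolding R_232_inverse(2) R_232_inv_def
    by (subst op_trace_smult, simp, simp, subst op_trace_add, simp, simp, simp, subst op_trace_smult)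
       (auto simp: Z I *[simplified] intro!: eq_matI)
qed

section \<open>Trivial links\<close>

definition round_circles :: "nat \<Rightarrow> link" where
  "round_circles n = (n, \<lambda>i t. (rcis 2 (2 * pi * t), real (i + 1)))"

lemma rcis_turn_eq_iff: "rcis 2 (2 * pi * s) = rcis 2 (2 * pi * t) \<longleftrightarrow> s - t \<in> \<int>"
proof
  assume "rcis 2 (2 * pi * s) = rcis 2 (2 * pi * t)"
  then have "sin (2 * pi * s) = sin (2 * pi * t) \<and> cos (2 * pi * s) = cos (2 * pi * t)"
    by (auto simp: complex_eq_iff)
  then obtain n :: int where "2 * pi * s = 2 * pi * t + 2 * pi * n"
    unfolding sin_cos_eq_iff by blast
  then have "2 * pi * s = 2 * pi * (t + n)" by (simp add: algebra_simps)
  then have "s - t = of_int n" by simp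
  then show "s - t \<in> \<int>" by simp
next
  assume "s - t \<in> \<int>"
  then have "rcis 2 (2 * pi * t) * cis (2 * pi * (s - t)) = rcis 2 (2 * pi * t)" by simp
  then show "rcis 2 (2 * pi * s) = rcis 2 (2 * pi * t)"
    by (simp add: rcis_def cis_mult algebra_simps)
qed

lemma oriented_round_circles: "oriented_link (round_circles n)"
  by (auto simp: oriented_link_def round_circles_def rcis_turn_eq_iff
      intro!: continuous_intros)

text \<open>
  The closure of the empty word consists of one sector, in which all strands stay at distance \<open>2\<close>
  from the axis; reducing the parameter modulo \<open>1\<close> covers each circle by this sector.
\<close>
lemma closure_of_empty_word: "closure_of_word n [] (round_circles n)"
proof -
  let ?\<gamma> = "\<lambda>i t. (rcis 2 (2 * pi * t), real (i + 1))"
  have "(\<Union>i<n. range (?\<gamma> i)) = closed_braid_set n []"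
  proof (intro subset_antisym subsetI)
    fix x assume "x \<in> (\<Union>i<n. range (?\<gamma> i))"
    then obtain i t where i: "i < n" and x: "x = (rcis 2 (2 * pi * t), real (i + 1))" by auto
    have "rcis 2 (2 * pi * t) = rcis 2 (2 * pi * frac t)"
      by (simp add: rcis_turn_eq_iff frac_def)
    moreover have "frac t \<in> {0..1}" using frac_lt_1[of t] by (simp add: less_imp_le)
    ultimately show "x \<in> closed_braid_set n []"
      using i unfolding closed_braid_set_def x
      by (intro CollectI exI[of _ 2] exI[of _ "real (i + 1)"] exI[of _ 0] exI[of _ "frac t"]
          exI[of _ "i + 1"]) simp
  next
    fix x assume "x \<in> closed_braid_set n []"
    then obtain s j where "1 \<le> j" "j \<le> n" "x = (rcis 2 (2 * pi * s), real j)"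
      by (auto simp: closed_braid_set_def)
    then show "x \<in> (\<Union>i<n. range (?\<gamma> i))"
      by (auto intro!: bexI[of _ "j - 1"])
  qed
  moreover have "continuous_on UNIV (\<lambda>t. 2 * pi * t) \<and> strict_mono (\<lambda>t. 2 * pi * t)"
    by (auto intro!: continuous_intros strict_monoI)
  then have "\<exists>\<theta>. continuous_on UNIV \<theta> \<and> strict_mono \<theta> \<and>
      (\<forall>t. fst (?\<gamma> i t) = rcis (norm (fst (?\<gamma> i t))) (\<theta> t))" for i :: nat
    by (intro exI[of _ "\<lambda>t. 2 * pi * t"]) simp
  ultimately show ?thesis
    using oriented_round_circles[of n] by (simp add: closure_of_word_def round_circles_def)
qed

lemma trivial_link_closure:
  "trivial_link n G \<Longrightarrow> isotopic_to_closure n (\<one>\<^bsub>braid_group n\<^esub>) G"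
  unfolding isotopic_to_closure_def trivial_link_def round_circles_def[symmetric]
  by (auto intro!: bexI[of _ "[]"] exI[of _ "fst (round_circles n)"] exI[of _ "snd (round_circles n)"]
      simp: closure_of_empty_word one_braid_group mem_braid_of braid_eq.refl)

lemma associated_link_invariantD:
  "associated_link_invariant F T \<Longrightarrow> 1 \<le> n \<Longrightarrow> \<xi> \<in> carrier (braid_group n) \<Longrightarrow>
    oriented_link L \<Longrightarrow> isotopic_to_closure n \<xi> L \<Longrightarrow> T L = F n \<xi>"
  unfolding associated_link_invariant_def by blast

section \<open>The link invariant\<close>

theorem theorem4p2p1:
  fixes S :: enhanced
  assumes "S = (R_232, 1\<^sub>m 2, 1, 2 * complex_of_real (sqrt 2))"
  shows "EgYB_operator 2 3 2 S \<and>
    markov_invariant (T_braid 2 3 2 S) \<and>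
    (\<forall>T. associated_link_invariant (T_braid 2 3 2 S) T \<longrightarrow>
       (\<forall>Lm L0 Lp. skein_triple Lm L0 Lp \<longrightarrow>
          T Lp + T Lm = complex_of_real (sqrt 2) * T L0) \<and>
       (\<forall>n\<ge>1. \<forall>G. trivial_link n G \<longrightarrow>
          T G = complex_of_real (sqrt 2) powi (- int n) * 2 ^ (n - 1)))"
proof -
  let ?\<beta> = "2 * complex_of_real (sqrt 2)"
  interpret gYB 2 3 2 R_232 by unfold_locales (simp_all add: gYB_R_232)
  have T_eq: "T_braid 2 3 2 S n \<xi> = ?\<beta> powi (- int n) * mat_trace (rho 2 3 2 R_232 n \<xi>)"
    if "\<xi> \<in> carrier (braid_group n)" for n \<xi>
    using rho_carrier[OF that] by (simp add: T_braid_def assms tensor_power_one)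
  have enhanced: "EgYB_operator 2 3 2 S"
    unfolding assms using op_trace_R_232 by (intro EgYB_operator_identity) simp_all
  have markov: "markov_invariant (T_braid 2 3 2 S)"
    unfolding assms using op_trace_R_232 by (intro markov_invariant_T_braid) simp_all
  have skein: "T Lp + T Lm = complex_of_real (sqrt 2) * T L0"
    if T: "associated_link_invariant (T_braid 2 3 2 S) T" and "skein_triple Lm L0 Lp" for T Lm L0 Lp
  proof -
    obtain n \<xi> where n: "2 \<le> n" and \<xi>: "\<xi> \<in> carrier (braid_group n)"
      and links: "oriented_link Lm" "oriented_link L0" "oriented_link Lp"
      and closures: "isotopic_to_closure n \<xi> L0"
        "isotopic_to_closure n (sigma n 1 \<otimes>\<^bsub>braid_group n\<^esub> \<xi>) Lp"
        "isotopic_to_closure n (inv\<^bsub>braid_group n\<^esub> sigma n 1 \<otimes>\<^bsub>braid_group n\<^esub> \<xi>) Lm"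
      using \<open>skein_triple Lm L0 Lp\<close> unfolding skein_triple_def by blast
    interpret B: group "braid_group n" by (rule group_braid_group)
    have s: "sigma n 1 \<in> carrier (braid_group n)"
      using n by (simp add: sigma_eq carrier_braid_group)
    have val: "T L = ?\<beta> powi (- int n) * mat_trace (rho 2 3 2 R_232 n \<eta>)"
      if "\<eta> \<in> carrier (braid_group n)" "oriented_link L" "isotopic_to_closure n \<eta> L" for \<eta> L
      using associated_link_invariantD[OF T _ that] n T_eq[OF that(1)] by simp
    have "mat_trace (rho 2 3 2 R_232 n (sigma n 1 \<otimes>\<^bsub>braid_group n\<^esub> \<xi>)) +
        mat_trace (rho 2 3 2 R_232 n (inv\<^bsub>braid_group n\<^esub> sigma n 1 \<otimes>\<^bsub>braid_group n\<^esub> \<xi>)) =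
      complex_of_real (sqrt 2) * mat_trace (rho 2 3 2 R_232 n \<xi>)"
      using R_232_add_inverse n \<xi> by (intro trace_rho_skein) simp_all
    moreover have "T L0 = ?\<beta> powi (- int n) * mat_trace (rho 2 3 2 R_232 n \<xi>)"
      "T Lp = ?\<beta> powi (- int n) * mat_trace (rho 2 3 2 R_232 n (sigma n 1 \<otimes>\<^bsub>braid_group n\<^esub> \<xi>))"
      "T Lm = ?\<beta> powi (- int n) *
        mat_trace (rho 2 3 2 R_232 n (inv\<^bsub>braid_group n\<^esub> sigma n 1 \<otimes>\<^bsub>braid_group n\<^esub> \<xi>))"
      using val[OF \<xi> links(2) closures(1)] val[OF _ links(3) closures(2)]
        val[OF _ links(1) closures(3)] \<xi> s by simp_all
    ultimately show ?thesis by (simp only: distrib_left[symmetric] mult.left_commute)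
  qed
  have trivial: "T G = complex_of_real (sqrt 2) powi (- int n) * 2 ^ (n - 1)"
    if T: "associated_link_invariant (T_braid 2 3 2 S) T" and n: "1 \<le> n"
      and G: "trivial_link n G" for T n G
  proof -
    interpret B: group "braid_group n" by (rule group_braid_group)
    have "T G = T_braid 2 3 2 S n (\<one>\<^bsub>braid_group n\<^esub>)"
      using G by (intro associated_link_invariantD[OF T n _ _ trivial_link_closure])
        (simp_all add: trivial_link_def)
    also have "\<dots> = ?\<beta> powi (- int n) * 2 ^ num_factors 3 2 n"
      by (simp add: T_eq rho_one mat_trace_one)
    also have "\<dots> = complex_of_real (sqrt 2) powi (- int n) * 2 ^ (n - 1)"
    proof -
      have "num_factors 3 2 n = n + (n - 1)" using n by (simp add: num_factors_def)
      then show ?thesis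
        by (simp add: power_int_minus power_mult_distrib power_add field_simps)
    qed
    finally show ?thesis .
  qed
  show ?thesis using enhanced markov skein trivial by blast
qed

end
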